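(* Let $a,b,c,\mu\in\mathbb{C}$. In each identity below assume that the arguments of the three gamma functions in the numerator on the right-hand side have positive real parts, and that the lower (third) parameters of the hypergeometric functions in the two $w_j$'s occurring are not in $\mathbb{Z}_{\le0}$. (1) For $x\in(0,1)\cup(1,\infty)$: $$\int_{-\infty}^0(-y)^{c-1}(1-y)^{a+b-c}w_1(y;a,b,c)(x-y)^{\mu-1}dy=\frac{\Gamma(-a-\mu+1)\Gamma(-b-\mu+1)\Gamma(c)}{\Gamma(c-a-b-\mu+1)\Gamma(1-\mu)}\,x^{c+\mu-1}|1-x|^{a+b-c+\mu}w_6(x;a+\mu,b+\mu,c+\mu).$$ (2) For $x\in(-\infty,0)\cup(0,1)$: $$\int_1^\infty y^{c-1}(y-1)^{a+b-c}w_5(y;a,b,c)(y-x)^{\mu-1}dy=\frac{\Gamma(-a-\mu+1)\Gamma(-b-\mu+1)\Gamma(a+b-c+1)}{\Gamma(2-c-\mu)\Gamma(1-\mu)}|x|^{c+\mu-1}(1-x)^{a+b-c+\mu}w_2(x;a+\mu,b+\mu,c+\mu).$$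
   Context: Write $F(a,b;c;z)={}_2F_1(a,b;c;z)$ for the Gauss hypergeometric function (power series for $|z|<1$, analytically continued to $\mathbb{C}\setminus[1,\infty)$, with $c\notin\mathbb{Z}_{\le0}$). Define $w_1(x;a,b,c)=F(a,b;c;x)$ for $x\in(-\infty,1)$; $w_2(x;a,b,c)=|x|^{1-c}F(a-c+1,b-c+1;2-c;x)$ for $x\in(-\infty,0)\cup(0,1)$; $w_5(x;a,b,c)=F(a,b;a+b-c+1;1-x)$ for $x\in(0,\infty)$; $w_6(x;a,b,c)=|1-x|^{c-a-b}F(c-a,c-b;c-a-b+1;1-x)$ for $x\in(0,1)\cup(1,\infty)$. Convention: $1/\Gamma$ is entire, with value $0$ at nonpositive integers. *)

theory Defs
  imports "HOL-Analysis.Analysis"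
begin

text \<open>
  The Gauss function \<open>F(a,b;c;z)\<close> for \<open>c \<notin> \<int>\<^sub>\<le>\<^sub>0\<close>: the analytic continuation of the
  hypergeometric series from the unit disc to the plane slit along \<open>[1,\<infinity>)\<close>. On the slit plane,
  which is connected, the values are uniquely determined; on the slit they are unspecified.
\<close>

definition hyp2F1 :: "complex \<Rightarrow> complex \<Rightarrow> complex \<Rightarrow> complex \<Rightarrow> complex" where
  "hyp2F1 a b c =
     (SOME f. f holomorphic_on (- complex_of_real ` {1..}) \<and>
              (\<forall>z. norm z < 1 \<longrightarrow> f z = eval_fps (fps_hypergeo [a, b] [c] 1) z))"

text \<open>
  Each of the following is meaningful only for real \<open>x\<close> in the indicated set.
\<close>

text \<open>\<open>x \<in> (-\<infinity>,1)\<close>:\<close>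
definition w1 :: "real \<Rightarrow> complex \<Rightarrow> complex \<Rightarrow> complex \<Rightarrow> complex" where
  "w1 x a b c = hyp2F1 a b c (of_real x)"

text \<open>\<open>x \<in> (-\<infinity>,0) \<union> (0,1)\<close>:\<close>
definition w2 :: "real \<Rightarrow> complex \<Rightarrow> complex \<Rightarrow> complex \<Rightarrow> complex" where
  "w2 x a b c =
     of_real \<bar>x\<bar> powr (1 - c) * hyp2F1 (a - c + 1) (b - c + 1) (2 - c) (of_real x)"

text \<open>\<open>x \<in> (0,\<infinity>)\<close>:\<close>
definition w5 :: "real \<Rightarrow> complex \<Rightarrow> complex \<Rightarrow> complex \<Rightarrow> complex" where
  "w5 x a b c = hyp2F1 a b (a + b - c + 1) (of_real (1 - x))"

text \<open>\<open>x \<in> (0,1) \<union> (1,\<infinity>)\<close>:\<close>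
definition w6 :: "real \<Rightarrow> complex \<Rightarrow> complex \<Rightarrow> complex \<Rightarrow> complex" where
  "w6 x a b c =
     of_real \<bar>1 - x\<bar> powr (c - a - b) *
       hyp2F1 (c - a) (c - b) (c - a - b + 1) (of_real (1 - x))"

end

theory Submission
  imports Defs "HOL-Complex_Analysis.Complex_Analysis" "HOL-Real_Asymp.Real_Asymp"
begin

text \<open>
  The substitution \<open>y = u / (u - 1)\<close> and Pfaff's transformation turn the integral in (1) into
  \<open>\<integral>\<^sub>0\<^sup>1 u\<^bsup>c-1\<^esup> (1-u)\<^bsup>-b-\<mu>\<^esup> F(a,c-b;c;u) (1 - (1-x)(1-u))\<^bsup>\<mu>-1\<^esup> du\<close>.
  For \<open>|1-x| < 1\<close> one expands the last factor binomially and \<open>F\<close> in its power series; the Beta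
  integral and Gauss's summation theorem evaluate each term and give a multiple of
  \<open>F(1-a-\<mu>,1-b-\<mu>;c-a-b-\<mu>+1;1-x)\<close>. Both sides are holomorphic in \<open>x\<close> off \<open>(-\<infinity>,0]\<close>, so the identity
  persists there, and Euler's transformation brings it into the required form. Statement (2) is (1)
  for \<open>a+b-c+1\<close> and \<open>1-x\<close> in place of \<open>c\<close> and \<open>x\<close>, after \<open>y \<mapsto> 1-y\<close>.

  The same integral, with \<open>c\<close> large, continues \<open>F(A,B;C;z)\<close> to the slit plane when
  \<open>Re A, Re B > 0\<close>; the remaining parameters are reached by integrating
  \<open>F' = (AB/C) F(A+1,B+1;C+1;z)\<close>.
\<close>

section \<open>Coefficients of the hypergeometric series\<close>

text \<open>\<open>hyp2F1\<close> is a choice, so nothing is known about it until a continuation has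
  been constructed. Using the integral for this is not circular: for \<open>u\<close> in
  \<open>{0<..<1}\<close> it involves \<open>F\<close> only inside the unit disc, where
  \<open>F\<close> is a power series, and the variable \<open>x\<close> sits in the other factor
  alone. The integral is computable because of its exponent. Gauss's theorem produces a reciprocal
  gamma factor with argument \<open>1 - \<mu> + m\<close>, and the binomial series of exponent
  \<open>\<mu> - 1\<close> contributes just the Pochhammer symbol of \<open>1 - \<mu>\<close> that
  reduces it to \<open>rGamma (1 - \<mu>)\<close>; what would be a 3F2 collapses to a 2F1. The three
  gamma factors in the numerator are the convergence conditions: \<open>Re c > 0\<close> at
  \<open>u = 0\<close>, the other two at \<open>u = 1\<close>, where \<open>F(a,c-b;c;u)\<close> is
  generically a combination of a constant and the power \<open>b - a\<close> of
  \<open>1 - u\<close>. Convergence of the hypergeometric series, in the disc and at 1, comes from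
  one estimate, the power growth of the coefficients.\<close>

lemma pochhammer_growth:
  fixes z :: complex
  shows "(\<lambda>n. norm (pochhammer z n) / fact n * (real n + 1) powr (1 - Re z)) \<longlonglongrightarrow> norm (rGamma z)"
proof -
  \<comment> \<open>The limit in question is Gauss's product for \<open>1 / Gamma\<close>, whose
    \<open>n\<close>-th term contains \<open>pochhammer z (Suc n)\<close>. This factor turns its
    \<open>fact n\<close> and its power of \<open>n\<close> into \<open>fact (Suc n)\<close> and a
    power of \<open>n + 2\<close>; the index is shifted back at the end. The base
    \<open>n + 1\<close> of the statement stays positive at \<open>n = 0\<close>.\<close>
  have "((\<lambda>n. real n powr Re z * (real n + 2) powr (1 - Re z) / (real n + 1)) \<longlongrightarrow> 1) at_top"
    by real_asymp
  hence "(\<lambda>n. norm (rGamma_series z n) *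
          (real n powr Re z * (real n + 2) powr (1 - Re z) / (real n + 1))) \<longlonglongrightarrow> norm (rGamma z) * 1"
    by (intro tendsto_mult tendsto_norm rGamma_series_LIMSEQ)
  moreover have "eventually (\<lambda>n. norm (rGamma_series z n) *
          (real n powr Re z * (real n + 2) powr (1 - Re z) / (real n + 1)) =
        norm (pochhammer z (Suc n)) / fact (Suc n) * (real (Suc n) + 1) powr (1 - Re z)) at_top"
    using eventually_gt_at_top[of "0::nat"]
  proof eventually_elim
    case (elim n)
    have "norm (exp (z * of_real (ln (of_nat n)))) = real n powr Re z"
      using elim by (simp add: powr_def)
    thus ?case using elim
      by (simp add: rGamma_series_def norm_divide norm_mult field_simps del: pochhammer_Suc)
  qed
  ultimately have "(\<lambda>n. norm (pochhammer z (Suc n)) / fact (Suc n) *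
      (real (Suc n) + 1) powr (1 - Re z)) \<longlonglongrightarrow> norm (rGamma z)"
    by (simp add: tendsto_cong)
  thus ?thesis by (rule LIMSEQ_imp_Suc)
qed

definition hyp_coeff :: "complex \<Rightarrow> complex \<Rightarrow> complex \<Rightarrow> nat \<Rightarrow> complex" where
  "hyp_coeff a b c n = pochhammer a n * pochhammer b n / (pochhammer c n * fact n)"

lemma fps_nth_hypergeo_2F1: "fps_nth (fps_hypergeo [a, b] [c] 1) n = hyp_coeff a b c n"
  by (simp add: hyp_coeff_def)

text \<open>The limit of the quotient of growth factors is finite because \<open>rGamma c\<close>
  does not vanish. Convergent sequences are bounded, so the estimate holds for every
  \<open>n\<close>, not merely eventually. The exponent is below -1 exactly when
  \<open>Re (c - a - b) > 0\<close>.\<close>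

lemma hyp_coeff_bound:
  assumes "c \<notin> \<int>\<^sub>\<le>\<^sub>0"
  obtains K where "K > 0"
    "\<And>n. norm (hyp_coeff a b c n) \<le> K * (real n + 1) powr (Re a + Re b - Re c - 1)"
proof -
  let ?P = "\<lambda>z n. norm (pochhammer z n) / fact n * (real n + 1) powr (1 - Re z)"
  have "(\<lambda>n. ?P a n * ?P b n / ?P c n) \<longlonglongrightarrow>
          norm (rGamma a) * norm (rGamma b) / norm (rGamma c)"
    using assms by (intro tendsto_intros pochhammer_growth) (simp add: rGamma_eq_zero_iff)
  hence "Bseq (\<lambda>n. ?P a n * ?P b n / ?P c n)"
    by (rule convergent_imp_Bseq[OF convergentI])
  then obtain K where K: "K > 0" "\<And>n. norm (?P a n * ?P b n / ?P c n) \<le> K"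
    unfolding Bseq_def by blast
  show thesis
  proof (rule that[OF K(1)])
    fix n
    have "?P a n * ?P b n / ?P c n =
        norm (hyp_coeff a b c n) * ((real n + 1) powr (1 - Re a) * (real n + 1) powr (1 - Re b) *
          (real n + 1) powr (Re c - 1))"
      by (simp add: hyp_coeff_def norm_mult norm_divide field_simps flip: powr_minus_divide)
         (simp add: powr_diff)
    also have "\<dots> = norm (hyp_coeff a b c n) * (real n + 1) powr (- (Re a + Re b - Re c - 1))"
      by (simp flip: powr_add add: algebra_simps)
    finally have "norm (hyp_coeff a b c n) * (real n + 1) powr (- (Re a + Re b - Re c - 1)) \<le> K"
      using K(2)[of n] by simp
    thus "norm (hyp_coeff a b c n) \<le> K * (real n + 1) powr (Re a + Re b - Re c - 1)"
      unfolding powr_minus by (simp add: pos_divide_le_eq flip: divide_inverse)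
  qed
qed

lemma summable_Suc_powr: "s < -1 \<Longrightarrow> summable (\<lambda>n. (real n + 1) powr s)"
  using summable_Suc_iff[of "\<lambda>n. real n powr s"] by (simp add: summable_real_powr_iff add.commute)

lemma summable_norm_hyp_coeff:
  assumes "c \<notin> \<int>\<^sub>\<le>\<^sub>0" "Re (c - a - b) > 0"
  shows "summable (\<lambda>n. norm (hyp_coeff a b c n))"
proof -
  obtain K where K: "\<And>n. norm (hyp_coeff a b c n) \<le> K * (real n + 1) powr (Re a + Re b - Re c - 1)"
    using hyp_coeff_bound[OF assms(1)] by metis
  show ?thesis
    by (rule summable_comparison_test'[OF summable_mult[OF summable_Suc_powr]])
       (use assms(2) K in auto)
qed

text \<open>Coefficients of at most power growth are beaten by \<open>r ^ n\<close> for every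
  \<open>r < 1\<close>. Only an inequality can hold: for \<open>a\<close> or \<open>b\<close> in
  \<open>\<int>\<^sub>\<le>\<^sub>0\<close> the series terminates.\<close>

lemma fps_conv_radius_hypergeo_2F1:
  fixes a b c :: complex
  assumes "c \<notin> \<int>\<^sub>\<le>\<^sub>0"
  shows "fps_conv_radius (fps_hypergeo [a, b] [c] 1) \<ge> 1"
proof -
  obtain K where K: "\<And>n. norm (hyp_coeff a b c n) \<le> K * (real n + 1) powr (Re a + Re b - Re c - 1)"
    using hyp_coeff_bound[OF assms(1)] by metis
  define s where "s = Re a + Re b - Re c - 1"
  show ?thesis unfolding fps_conv_radius_def fps_nth_hypergeo_2F1[abs_def]
  proof (rule conv_radius_geI_ex)
    fix r :: real assume "0 < r" "ereal r < 1"
    hence r: "0 < r" "r < 1" by simp_all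
    hence "((\<lambda>n. (real n + 1) powr s * r ^ n / (real n powr (-2))) \<longlongrightarrow> 0) at_top"
      by real_asymp
    hence "(\<lambda>n. (real n + 1) powr s * r ^ n) \<in> o(\<lambda>n. real n powr (-2))"
      by (intro smalloI_tendsto eventually_mono[OF eventually_gt_at_top[of "0::nat"]]) auto
    hence "(\<lambda>n. (real n + 1) powr s * r ^ n) \<in> O(\<lambda>n. real n powr (-2))"
      by (rule landau_o.small_imp_big)
    moreover have "summable (\<lambda>n. norm (real n powr (-2)))"
      by (simp add: summable_real_powr_iff)
    ultimately have "summable (\<lambda>n. (real n + 1) powr s * r ^ n)"
      by (rule summable_comparison_test_bigo[rotated])
    hence "summable (\<lambda>n. K * ((real n + 1) powr s * r ^ n))"
      by (rule summable_mult)
    hence "summable (\<lambda>n. hyp_coeff a b c n * of_real r ^ n)"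
    proof (rule summable_comparison_test')
      fix n
      show "norm (hyp_coeff a b c n * of_real r ^ n) \<le> K * ((real n + 1) powr s * r ^ n)"
        using mult_right_mono[OF K[of n], of "r ^ n"] r
        by (simp add: norm_mult norm_power s_def mult.assoc)
    qed
    thus "\<exists>z. norm z = r \<and> summable (\<lambda>n. hyp_coeff a b c n * z ^ n)"
      using r by (intro exI[of _ "of_real r"]) auto
  qed
qed

lemma sums_hypergeo_2F1:
  assumes "c \<notin> \<int>\<^sub>\<le>\<^sub>0" "norm z < 1"
  shows "(\<lambda>n. hyp_coeff a b c n * z ^ n) sums eval_fps (fps_hypergeo [a, b] [c] 1) z"
    and "summable (\<lambda>n. norm (hyp_coeff a b c n * z ^ n))"
proof -
  have "ereal (norm z) < fps_conv_radius (fps_hypergeo [a, b] [c] 1)"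
    using assms by (intro less_le_trans[OF _ fps_conv_radius_hypergeo_2F1]) auto
  from sums_eval_fps[OF this] norm_summable_fps[OF this]
  show "(\<lambda>n. hyp_coeff a b c n * z ^ n) sums eval_fps (fps_hypergeo [a, b] [c] 1) z"
    and "summable (\<lambda>n. norm (hyp_coeff a b c n * z ^ n))"
    unfolding fps_nth_hypergeo_2F1 by auto
qed

lemma hyp_coeff_Suc:
  "hyp_coeff a b c (Suc n) =
     hyp_coeff a b c n * ((a + of_nat n) * (b + of_nat n) / ((c + of_nat n) * of_nat (Suc n)))"
  by (simp add: hyp_coeff_def pochhammer_Suc mult_ac)

lemma hyp_coeff_lower_plus1:
  assumes "c \<notin> \<int>\<^sub>\<le>\<^sub>0"
  shows "hyp_coeff a b (c + 1) n = hyp_coeff a b c n * (c / (c + of_nat n))"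
proof -
  have nz: "c + of_nat n \<noteq> 0"
    using assms by (metis add_eq_0_iff minus_of_nat_in_nonpos_Ints add.commute neg_eq_iff_add_eq_0)
  have "c \<noteq> 0" using assms by auto
  have "c * pochhammer (c + 1) n = pochhammer c n * (c + of_nat n)"
    by (metis pochhammer_Suc pochhammer_rec)
  hence "pochhammer (c + 1) n = pochhammer c n * (c + of_nat n) / c"
    using \<open>c \<noteq> 0\<close> by (simp add: field_simps)
  thus ?thesis using nz by (simp add: hyp_coeff_def)
qed

lemma Re_pos_notin_nonpos_Ints: "Re z > 0 \<Longrightarrow> z \<notin> \<int>\<^sub>\<le>\<^sub>0"
  by (auto elim!: nonpos_Ints_cases)

section \<open>Gauss's summation theorem\<close>

text \<open>A contiguous relation at the point 1. It telescopes: termwise, the difference of the two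
  sides is the forward difference of \<open>c * n * hyp_coeff a b c n\<close>.\<close>

lemma Gauss_sum_plus1:
  assumes "c \<notin> \<int>\<^sub>\<le>\<^sub>0" "Re (c - a - b) > 0"
  shows "(c - a) * (c - b) * (\<Sum>n. hyp_coeff a b (c + 1) n) =
           c * (c - a - b) * (\<Sum>n. hyp_coeff a b c n)"
proof -
  have nz: "c + of_nat n \<noteq> 0" for n
    using assms by (metis add_eq_0_iff minus_of_nat_in_nonpos_Ints add.commute neg_eq_iff_add_eq_0)
  have c1: "c + 1 \<notin> \<int>\<^sub>\<le>\<^sub>0"
    using assms(1) plus_one_in_nonpos_Ints_imp by blast
  have S0: "summable (hyp_coeff a b c)"
    using summable_norm_hyp_coeff[OF assms] by (rule summable_norm_cancel)
  have S1: "summable (hyp_coeff a b (c + 1))"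
    by (rule summable_norm_cancel[OF summable_norm_hyp_coeff[OF c1]]) (use assms(2) in auto)
  have step: "(c - a) * (c - b) * hyp_coeff a b (c + 1) n - c * (c - a - b) * hyp_coeff a b c n =
      c * (of_nat (Suc n) * hyp_coeff a b c (Suc n)) - c * (of_nat n * hyp_coeff a b c n)" for n
    unfolding hyp_coeff_Suc hyp_coeff_lower_plus1[OF assms(1)]
    using nz[of n] by (simp add: divide_simps del: of_nat_Suc) (simp add: algebra_simps)
  \<comment> \<open>The telescoping sum needs \<open>n * hyp_coeff a b c n\<close> to vanish at
    infinity; it is of order \<open>n powr s\<close> with \<open>s = Re (a + b - c)\<close>, which
    is negative.\<close>
  obtain K where K: "\<And>n. norm (hyp_coeff a b c n) \<le> K * (real n + 1) powr (Re a + Re b - Re c - 1)"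
    using hyp_coeff_bound[OF assms(1)] by metis
  define s where "s = Re a + Re b - Re c"
  have "s < 0" using assms(2) by (simp add: s_def)
  hence "((\<lambda>n. real n * (K * (real n + 1) powr (s - 1))) \<longlongrightarrow> 0) at_top"
    by real_asymp
  hence lim: "(\<lambda>n. of_nat n * hyp_coeff a b c n) \<longlonglongrightarrow> 0"
    by (rule Lim_null_comparison[rotated])
       (use K in \<open>auto simp: norm_mult s_def intro!: mult_left_mono always_eventually\<close>)
  have "(\<lambda>n. c * (of_nat (Suc n) * hyp_coeff a b c (Suc n)) - c * (of_nat n * hyp_coeff a b c n))
      sums (c * 0 - c * (of_nat 0 * hyp_coeff a b c 0))"
    by (rule telescope_sums) (intro tendsto_mult lim tendsto_const)
  moreover have "(\<lambda>n. (c - a) * (c - b) * hyp_coeff a b (c + 1) n - c * (c - a - b) * hyp_coeff a b c n)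
      sums ((c - a) * (c - b) * (\<Sum>n. hyp_coeff a b (c + 1) n) -
              c * (c - a - b) * (\<Sum>n. hyp_coeff a b c n))"
    using S0 S1 by (intro sums_diff sums_mult summable_sums)
  ultimately show ?thesis
    unfolding step by (auto dest: sums_unique2)
qed

text \<open>Kept free of division, since the Pochhammer symbols of \<open>c - a\<close> and
  \<open>c - b\<close> may vanish.\<close>

lemma Gauss_sum_plus_nat:
  assumes "Re c > 0" "Re (c - a - b) > 0"
  shows "pochhammer (c - a) N * pochhammer (c - b) N * (\<Sum>n. hyp_coeff a b (c + of_nat N) n) =
           pochhammer c N * pochhammer (c - a - b) N * (\<Sum>n. hyp_coeff a b c n)"
proof (induction N)
  case (Suc N)
  have eq: "(c + of_nat N - a) * (c + of_nat N - b) * (\<Sum>n. hyp_coeff a b (c + of_nat N + 1) n) =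
           (c + of_nat N) * (c + of_nat N - a - b) * (\<Sum>n. hyp_coeff a b (c + of_nat N) n)"
    using assms by (intro Gauss_sum_plus1 Re_pos_notin_nonpos_Ints) auto
  have "pochhammer (c - a) (Suc N) * pochhammer (c - b) (Suc N) * (\<Sum>n. hyp_coeff a b (c + of_nat (Suc N)) n) =
     pochhammer (c - a) N * pochhammer (c - b) N * ((c + of_nat N - a) * (c + of_nat N - b) *
       (\<Sum>n. hyp_coeff a b (c + of_nat N + 1) n))"
    by (simp add: pochhammer_Suc algebra_simps)
  also have "\<dots> = (c + of_nat N) * (c + of_nat N - a - b) *
       (pochhammer (c - a) N * pochhammer (c - b) N * (\<Sum>n. hyp_coeff a b (c + of_nat N) n))"
    unfolding eq by (simp only: mult_ac)
  also have "\<dots> = pochhammer c (Suc N) * pochhammer (c - a - b) (Suc N) * (\<Sum>n. hyp_coeff a b c n)"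
    unfolding Suc.IH by (simp add: pochhammer_Suc algebra_simps)
  finally show ?case .
qed simp

text \<open>As the lower parameter tends to infinity only the term of index 0 survives. Tannery's
  theorem justifies taking the limit termwise.\<close>

lemma Gauss_sum_tendsto_1:
  assumes "Re c > 0" "Re (c - a - b) > 0"
  shows "(\<lambda>N. \<Sum>n. hyp_coeff a b (c + of_nat N) n) \<longlonglongrightarrow> 1"
proof -
  \<comment> \<open>The product of zeros is the factorwise limit of the reciprocals of
    \<open>c + N + i\<close>; for \<open>k = 0\<close> it is empty, hence 1.\<close>
  let ?b = "\<lambda>k. pochhammer a k * pochhammer b k / fact k * (\<Prod>i<k. 0)"
  have "(\<lambda>N. \<Sum>k. hyp_coeff a b (c + of_nat N) k) \<longlonglongrightarrow> (\<Sum>k. ?b k)"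
  proof (rule tannerys_theorem[THEN conjunct2, THEN conjunct2])
    fix k
    have "(\<lambda>N. inverse (c + of_nat N + of_nat i)) \<longlonglongrightarrow> 0" for i
    proof -
      have "filterlim (\<lambda>N. (c + of_nat i) + of_nat N) at_infinity sequentially"
        by (intro tendsto_add_filterlim_at_infinity[OF tendsto_const] tendsto_of_nat)
      thus ?thesis
        by (intro tendsto_inverse_0[THEN filterlim_compose]) (simp add: add_ac)
    qed
    hence "(\<lambda>N. pochhammer a k * pochhammer b k / fact k * (\<Prod>i<k. inverse (c + of_nat N + of_nat i)))
        \<longlonglongrightarrow> ?b k"
      by (intro tendsto_intros)
    thus "(\<lambda>N. hyp_coeff a b (c + of_nat N) k) \<longlonglongrightarrow> ?b k"
      unfolding hyp_coeff_def pochhammer_prod[of "c + _"] atLeast0LessThan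
      by (simp add: prod_inversef[unfolded o_def] divide_inverse mult_ac)
  next
    \<comment> \<open>Majorant independent of \<open>N\<close>: passing to the real lower parameter
      \<open>Re c > 0\<close> makes every factor of the denominator smaller.\<close>
    have "norm (hyp_coeff a b (c + of_nat N) k) \<le> norm (hyp_coeff a b (of_real (Re c)) k)" for k N
    proof -
      have "pochhammer (Re c) k \<le> norm (pochhammer (c + of_nat N) k)"
        unfolding pochhammer_prod prod_norm[symmetric]
      proof (intro prod_mono conjI)
        fix i
        have "Re c + real i \<le> Re (c + of_nat N + of_nat i)" by simp
        also have "\<dots> \<le> norm (c + of_nat N + of_nat i)" by (rule complex_Re_le_cmod)
        finally show "Re c + of_nat i \<le> norm (c + of_nat N + of_nat i)" by simp
      qed (use assms in auto)
      moreover have "norm (pochhammer (complex_of_real (Re c)) k) = pochhammer (Re c) k"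
        using pochhammer_nonneg[of "Re c" k] assms
        by (simp add: pochhammer_of_real)
      ultimately show ?thesis
        using pochhammer_pos[of "Re c" k] assms
        by (auto simp: hyp_coeff_def norm_divide norm_mult intro!: divide_left_mono mult_right_mono mult_pos_pos)
    qed
    thus "eventually (\<lambda>(k,N). norm (hyp_coeff a b (c + of_nat N) k) \<le>
             norm (hyp_coeff a b (of_real (Re c)) k)) (sequentially \<times>\<^sub>F sequentially)"
      by (auto intro: always_eventually)
    show "summable (\<lambda>k. norm (hyp_coeff a b (of_real (Re c)) k))"
      by (rule summable_norm_hyp_coeff[OF Re_pos_notin_nonpos_Ints]) (use assms in auto)
  qed auto
  also have "(\<Sum>k. ?b k) = (\<Sum>k\<in>{0}. ?b k)"
    by (rule suminf_finite) auto
  finally show ?thesis by simp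
qed

text \<open>Divide the \<open>Suc N\<close>-fold contiguous relation by the factorials and powers of
  \<open>N\<close> that turn Pochhammer symbols of length \<open>Suc N\<close> into terms of Gauss's
  product. These agree on both sides because \<open>(c - a) + (c - b) = c + (c - a - b)\<close>.
  Then let \<open>N\<close> tend to infinity.\<close>

lemma Gauss_sum:
  assumes "Re c > 0" "Re (c - a - b) > 0"
  shows "(\<Sum>n. hyp_coeff a b c n) = Gamma c * Gamma (c - a - b) * rGamma (c - a) * rGamma (c - b)"
proof -
  let ?S = "\<Sum>n. hyp_coeff a b c n"
  have nz: "c \<notin> \<int>\<^sub>\<le>\<^sub>0" "c - a - b \<notin> \<int>\<^sub>\<le>\<^sub>0"
    using assms by (auto intro!: Re_pos_notin_nonpos_Ints)
  have "rGamma_series (c - a) N * rGamma_series (c - b) N * (\<Sum>n. hyp_coeff a b (c + of_nat (Suc N)) n) =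
         rGamma_series c N * rGamma_series (c - a - b) N * ?S" for N
  proof -
    define L where "L = complex_of_real (ln (of_nat N))"
    define E where "E = (\<lambda>z::complex. exp (z * L))"
    have E: "E z = exp (z * L)" for z by (simp add: E_def)
    have "E (c - a) * E (c - b) = E c * E (c - a - b)"
      by (simp add: E_def algebra_simps flip: exp_add)
    moreover have "E z \<noteq> 0" for z by (simp add: E_def)
    ultimately show ?thesis
      using Gauss_sum_plus_nat[OF assms, of "Suc N"]
      unfolding rGamma_series_def L_def[symmetric] E[symmetric]
      by (simp add: divide_simps mult_ac)
  qed
  moreover have "(\<lambda>N. rGamma_series (c - a) N * rGamma_series (c - b) N *
       (\<Sum>n. hyp_coeff a b (c + of_nat (Suc N)) n)) \<longlonglongrightarrow> rGamma (c - a) * rGamma (c - b) * 1"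
    by (intro tendsto_mult rGamma_series_LIMSEQ LIMSEQ_Suc[OF Gauss_sum_tendsto_1[OF assms]])
  moreover have "(\<lambda>N. rGamma_series c N * rGamma_series (c - a - b) N * ?S) \<longlonglongrightarrow>
      rGamma c * rGamma (c - a - b) * ?S"
    by (intro tendsto_mult rGamma_series_LIMSEQ tendsto_const)
  ultimately have "rGamma (c - a) * rGamma (c - b) = rGamma c * rGamma (c - a - b) * ?S"
    using LIMSEQ_unique by auto
  thus ?thesis
    using nz by (simp add: Gamma_def divide_simps rGamma_eq_zero_iff mult_ac)
qed

section \<open>The Beta integral with complex parameters\<close>

text \<open>Local domination of the integrand itself suffices: Cauchy's inequality turns it into a
  bound on the derivative, hence on the difference quotients, to which dominated convergence
  applies.\<close>

lemma holomorphic_on_Bochner_integral: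
  fixes f :: "complex \<Rightarrow> 'a \<Rightarrow> complex"
  assumes S: "open S"
    and meas: "\<And>z. z \<in> S \<Longrightarrow> f z \<in> borel_measurable M"
    and hol: "\<And>u. u \<in> space M \<Longrightarrow> (\<lambda>z. f z u) holomorphic_on S"
    and dom: "\<And>z0. z0 \<in> S \<Longrightarrow> \<exists>r>0. \<exists>g. cball z0 r \<subseteq> S \<and> integrable M g \<and>
                (\<forall>z\<in>cball z0 r. \<forall>u\<in>space M. norm (f z u) \<le> g u)"
  shows "(\<lambda>z. \<integral>u. f z u \<partial>M) holomorphic_on S"
  unfolding holomorphic_on_open[OF S]
proof
  fix z0 assume z0: "z0 \<in> S"
  obtain r g where r: "r > 0" "cball z0 r \<subseteq> S" and g: "integrable M g"
    and le: "\<And>z u. z \<in> cball z0 r \<Longrightarrow> u \<in> space M \<Longrightarrow> norm (f z u) \<le> g u"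
    using dom[OF z0] by blast
  define D where "D = (\<lambda>u. deriv (\<lambda>z. f z u) z0)"
  have der: "((\<lambda>z. f z u) has_field_derivative deriv (\<lambda>z. f z u) w) (at w)"
    if "u \<in> space M" "w \<in> S" for u w
    using holomorphic_derivI[OF hol[OF that(1)] S that(2)] .
  \<comment> \<open>Half the radius leaves room for a disc of radius \<open>r / 2\<close> around
    each \<open>w\<close>, on which Cauchy's inequality can use the bound
    \<open>g u\<close>.\<close>
  have lip: "norm (f z u - f z0 u) \<le> g u / (r / 2) * norm (z - z0)"
    if z: "z \<in> ball z0 (r / 2)" and u: "u \<in> space M" for z u
  proof (rule field_differentiable_bound[where S = "ball z0 (r / 2)"])
    fix w assume w: "w \<in> ball z0 (r / 2)"
    have sub: "cball w (r / 2) \<subseteq> cball z0 r"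
      using w by (simp add: cball_subset_cball_iff dist_commute)
    hence sub': "cball w (r / 2) \<subseteq> S" using r by blast
    have "w \<in> cball w (r / 2)" using r by simp
    hence wS: "w \<in> S" using sub' by blast
    show "((\<lambda>z. f z u) has_field_derivative deriv (\<lambda>z. f z u) w) (at w within ball z0 (r / 2))"
      using der[OF u wS] by (rule has_field_derivative_at_within)
    have holw: "(\<lambda>z. f z u) holomorphic_on cball w (r / 2)"
      using hol[OF u] sub' by (rule holomorphic_on_subset)
    have "norm ((deriv ^^ 1) (\<lambda>z. f z u) w) \<le> fact 1 * g u / (r / 2) ^ 1"
    proof (rule Cauchy_inequality)
      show "(\<lambda>z. f z u) holomorphic_on ball w (r / 2)"
        using holw by (rule holomorphic_on_subset) auto
      show "continuous_on (cball w (r / 2)) (\<lambda>z. f z u)"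
        using holw by (rule holomorphic_on_imp_continuous_on)
      fix x assume "norm (w - x) = r / 2"
      hence "x \<in> cball w (r / 2)" by (simp add: dist_norm)
      thus "norm (f x u) \<le> g u" using sub le u by blast
    qed (use r(1) in simp)
    thus "norm (deriv (\<lambda>z. f z u) w) \<le> g u / (r / 2)" by simp
  qed (use r(1) z in simp_all)
  have "((\<lambda>z. \<integral>u. f z u \<partial>M) has_field_derivative (\<integral>u. D u \<partial>M)) (at z0)"
    unfolding has_field_derivative_iff tendsto_at_iff_sequentially
  proof (intro allI impI)
    fix X :: "nat \<Rightarrow> complex"
    assume X: "\<forall>i. X i \<in> UNIV - {z0}" "X \<longlonglongrightarrow> z0"
    from X(2) r obtain N where N: "\<And>n. n \<ge> N \<Longrightarrow> X n \<in> ball z0 (r / 2)"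
      by (metis centre_in_ball half_gt_zero_iff lim_explicit open_ball)
    define Y where "Y = (\<lambda>n. X (n + N))"
    have Y: "Y n \<in> ball z0 (r / 2)" "Y n \<noteq> z0" for n
      using N X(1) by (auto simp: Y_def)
    have YS: "Y n \<in> S" for n
      using Y(1)[of n] r by (auto simp: subset_iff)
    have Ylim: "Y \<longlonglongrightarrow> z0"
      unfolding Y_def using X(2) by (rule LIMSEQ_ignore_initial_segment)
    have int: "integrable M (f z)" if "z \<in> cball z0 r" for z
    proof (rule Bochner_Integration.integrable_bound[OF g meas])
      show "z \<in> S" using that r(2) by blast
      have "norm (f z u) \<le> norm (g u)" if "u \<in> space M" for u
        using le[OF \<open>z \<in> cball z0 r\<close> that] by simp
      thus "AE u in M. norm (f z u) \<le> norm (g u)" by (rule AE_I2)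
    qed
    define s where "s = (\<lambda>n u. (f (Y n) u - f z0 u) / (Y n - z0))"
    have s_meas: "s n \<in> borel_measurable M" for n
      unfolding s_def using meas[OF YS[of n]] meas[OF z0] by measurable
    have s_lim: "(\<lambda>n. s n u) \<longlonglongrightarrow> D u" if "u \<in> space M" for u
    proof -
      have "((\<lambda>z. (f z u - f z0 u) / (z - z0)) \<longlongrightarrow> D u) (at z0)"
        using der[OF that z0] by (simp add: has_field_derivative_iff D_def)
      from this[unfolded tendsto_at_iff_sequentially, rule_format, of Y]
      show ?thesis using Y Ylim by (auto simp: s_def o_def)
    qed
    have "(\<lambda>n. \<integral>u. s n u \<partial>M) \<longlonglongrightarrow> (\<integral>u. D u \<partial>M)"
    proof (rule integral_dominated_convergence[where w = "\<lambda>u. g u / (r / 2)"])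
      show "D \<in> borel_measurable M"
        by (rule borel_measurable_LIMSEQ_metric[OF s_meas s_lim])
      show "AE u in M. norm (s n u) \<le> g u / (r / 2)" for n
        using lip[OF Y(1)[of n]] Y(2)[of n]
        by (intro AE_I2) (simp add: s_def norm_divide pos_divide_le_eq)
      show "integrable M (\<lambda>u. g u / (r / 2))" using g by simp
      show "AE u in M. (\<lambda>n. s n u) \<longlonglongrightarrow> D u" by (rule AE_I2[OF s_lim])
    qed (rule s_meas)
    also have "(\<lambda>n. \<integral>u. s n u \<partial>M) =
        (\<lambda>n. ((\<integral>u. f (Y n) u \<partial>M) - (\<integral>u. f z0 u \<partial>M)) / (Y n - z0))"
    proof
      fix n
      have "Y n \<in> cball z0 r" "z0 \<in> cball z0 r"
        using Y(1)[of n] r by auto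
      thus "(\<integral>u. s n u \<partial>M) = ((\<integral>u. f (Y n) u \<partial>M) - (\<integral>u. f z0 u \<partial>M)) / (Y n - z0)"
        by (simp add: s_def int)
    qed
    finally show "((\<lambda>z. ((\<integral>u. f z u \<partial>M) - (\<integral>u. f z0 u \<partial>M)) / (z - z0)) \<circ> X)
        \<longlonglongrightarrow> (\<integral>u. D u \<partial>M)"
      unfolding Y_def o_def by (rule LIMSEQ_offset)
  qed
  thus "\<exists>f'. ((\<lambda>z. \<integral>u. f z u \<partial>M) has_field_derivative f') (at z0)" by blast
qed

lemma holomorphic_eq_on_halfplane:
  assumes "f holomorphic_on {z. Re z > 0}" "g holomorphic_on {z. Re z > 0}"
    and "\<And>x. x > 0 \<Longrightarrow> f (of_real x) = g (of_real x)" "Re z > 0"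
  shows "f z = g z"
proof -
  have "f z - g z = 0"
  proof (rule analytic_continuation[where f = "\<lambda>z. f z - g z" and S = "{z. Re z > 0}" and U = "of_real ` {0<..}" and \<xi> = 1])
    show "(1::complex) islimpt of_real ` {0<..}"
      unfolding islimpt_approachable
    proof (intro allI impI)
      fix e :: real assume "e > 0"
      thus "\<exists>x'\<in>of_real ` {0<..}. x' \<noteq> (1::complex) \<and> dist x' 1 < e"
        by (intro bexI[of _ "of_real (1 + e / 2)"] imageI) (auto simp: dist_norm)
    qed
    show "(\<lambda>z. f z - g z) holomorphic_on {z. Re z > 0}"
      by (intro holomorphic_intros assms)
    show "connected {z. Re z > 0}"
      by (intro convex_connected convex_halfspace_Re_gt)
  qed (use assms(3,4) in \<open>auto simp: open_halfspace_Re_gt\<close>)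
  thus ?thesis by simp
qed

definition Beta_kernel :: "complex \<Rightarrow> complex \<Rightarrow> real \<Rightarrow> complex" where
  "Beta_kernel p q u = of_real u powr (p - 1) * of_real (1 - u) powr (q - 1)"

lemma norm_Beta_kernel:
  "u \<in> {0<..<1} \<Longrightarrow> norm (Beta_kernel p q u) = u powr (Re p - 1) * (1 - u) powr (Re q - 1)"
  by (simp add: Beta_kernel_def norm_mult norm_powr_real_powr del: of_real_diff)

lemma continuous_on_Beta_kernel: "continuous_on {0<..<1} (Beta_kernel p q)"
  unfolding Beta_kernel_def
  by (intro continuous_intros) (auto simp del: of_real_diff)

lemma set_integrable_Beta_real:
  assumes "p > 0" "q > (0::real)"
  shows "set_integrable lborel {0<..<1} (\<lambda>u. u powr (p - 1) * (1 - u) powr (q - 1))"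
  by (rule set_integrable_subset[OF integrable_Beta[OF assms]]) auto

lemma set_borel_measurable_lborel_continuous:
  fixes f :: "real \<Rightarrow> 'a :: real_normed_vector"
  assumes "continuous_on A f" "A \<in> sets borel"
  shows "set_borel_measurable lborel A f"
  using borel_measurable_continuous_on_indicator[OF assms(2,1)]
  by (simp add: set_borel_measurable_def)

lemma set_integrable_Beta_kernel:
  assumes "Re p > 0" "Re q > 0"
  shows "set_integrable lborel {0<..<1} (Beta_kernel p q)"
  by (rule set_integrable_bound[OF set_integrable_Beta_real[OF assms]])
     (auto simp: norm_Beta_kernel intro!: set_borel_measurable_lborel_continuous continuous_on_Beta_kernel)

lemma Beta_integral_real:
  assumes "p > 0" "q > (0::real)"
  shows "(LINT u:{0<..<1}|lborel. u powr (p - 1) * (1 - u) powr (q - 1)) = Beta p q"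
proof -
  have "((\<lambda>t. t powr (p - 1) * (1 - t) powr (q - 1)) has_integral Beta p q) {0<..<1}"
    using has_integral_Beta_real[OF assms] by (simp add: has_integral_Icc_iff_Ioo)
  thus ?thesis
    using set_borel_integral_eq_integral(2)[OF set_integrable_Beta_real[OF assms]]
    by (simp add: integral_unique)
qed

text \<open>The real case is extended to complex parameters one at a time by the identity theorem on
  a half-plane. The symmetry \<open>u \<mapsto> 1 - u\<close> makes holomorphy in the first
  parameter enough.\<close>

lemma Beta_integral:
  assumes "Re p > 0" "Re q > 0"
  shows "(LINT u:{0<..<1}|lborel. Beta_kernel p q u) = Beta p q"
proof -
  define J where "J = (\<lambda>p q. LINT u:{0<..<1}|lborel. Beta_kernel p q u)"
  have sym: "J p q = J q p" for p q
    unfolding J_def set_lebesgue_integral_def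
    by (subst lborel_integral_real_affine[of "-1" _ 1])
       (auto intro!: Bochner_Integration.integral_cong simp: Beta_kernel_def indicator_def)
  have hol: "(\<lambda>p. J p q) holomorphic_on {z. Re z > 0}" if q: "Re q > 0" for q
    unfolding J_def set_lebesgue_integral_def
  proof (rule holomorphic_on_Bochner_integral)
    fix z assume "z \<in> {z. Re z > 0}"
    hence z: "Re z > 0" by simp
    show "(\<lambda>u. indicat_real {0<..<1} u *\<^sub>R Beta_kernel z q u) \<in> borel_measurable lborel"
      using set_integrable_Beta_kernel[OF z q] by (auto simp: set_integrable_def)
    show "\<exists>r>0. \<exists>g. cball z r \<subseteq> {z. Re z > 0} \<and> integrable lborel g \<and>
            (\<forall>w\<in>cball z r. \<forall>u\<in>space lborel. norm (indicat_real {0<..<1} u *\<^sub>R Beta_kernel w q u) \<le> g u)"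
    proof (intro exI conjI ballI)
      \<comment> \<open>On the disc of radius \<open>Re z / 2\<close> real parts stay above
        \<open>Re z / 2\<close>. As \<open>u < 1\<close>, the smallest exponent gives the largest
        power, hence the majorant.\<close>
      show "Re z / 2 > 0" using z by simp
      have Re_ge: "Re w \<ge> Re z / 2" if "w \<in> cball z (Re z / 2)" for w
        using that abs_Re_le_cmod[of "z - w"] by (simp add: dist_norm)
      thus "cball z (Re z / 2) \<subseteq> {z. Re z > 0}" using z by fastforce
      show "integrable lborel (\<lambda>u. indicat_real {0<..<1} u *\<^sub>R (u powr (Re z / 2 - 1) * (1 - u) powr (Re q - 1)))"
        using set_integrable_Beta_real[of "Re z / 2" "Re q"] z q by (simp add: set_integrable_def)
      fix w u assume "w \<in> cball z (Re z / 2)"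
      thus "norm (indicat_real {0<..<1} u *\<^sub>R Beta_kernel w q u) \<le>
              indicat_real {0<..<1} u *\<^sub>R (u powr (Re z / 2 - 1) * (1 - u) powr (Re q - 1))"
        using Re_ge[of w]
        by (auto simp: indicator_def norm_Beta_kernel intro!: mult_right_mono powr_mono')
    qed
  next
    fix u :: real
    show "(\<lambda>z. indicat_real {0<..<1} u *\<^sub>R Beta_kernel z q u) holomorphic_on {z. Re z > 0}"
    proof (cases "u \<in> {0<..<1}")
      case True
      hence "of_real u \<noteq> (0::complex)" "of_real (1 - u) \<noteq> (0::complex)"
        by (simp_all only: of_real_eq_0_iff) auto
      hence "(\<lambda>z. Beta_kernel z q u) holomorphic_on {z. Re z > 0}"
        unfolding Beta_kernel_def by (intro holomorphic_intros)
      thus ?thesis using True by simp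
    qed simp
  qed (simp add: open_halfspace_Re_gt)
  have holB: "(\<lambda>p. Beta p q) holomorphic_on {z. Re z > 0}" if "Re q > 0" for q :: complex
  proof (intro holomorphic_intros)
    fix z assume "z \<in> {z. Re z > 0}"
    thus "z \<notin> \<int>\<^sub>\<le>\<^sub>0" using Re_pos_notin_nonpos_Ints[of z] by simp
    show "q \<notin> \<int>\<^sub>\<le>\<^sub>0" using Re_pos_notin_nonpos_Ints[OF that] .
  qed
  have real: "J (of_real p) (of_real q) = Beta (of_real p) (of_real q)" if "p > 0" "q > 0" for p q
  proof -
    have "J (of_real p) (of_real q) =
        (LINT u:{0<..<1}|lborel. complex_of_real (u powr (p - 1) * (1 - u) powr (q - 1)))"
      unfolding J_def
      by (intro set_lebesgue_integral_cong)
         (auto simp: Beta_kernel_def simp flip: powr_of_real)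
    also have "\<dots> = of_real (LINT u:{0<..<1}|lborel. u powr (p - 1) * (1 - u) powr (q - 1))"
      by (rule set_integral_complex_of_real)
    finally show ?thesis using that by (simp add: Beta_integral_real Beta_complex_of_real)
  qed
  have part: "J z (of_real x) = Beta z (of_real x)" if "Re z > 0" "x > 0" for z x
    by (rule holomorphic_eq_on_halfplane[OF hol holB]) (use that real in simp_all)
  have "J (of_real x) p = Beta (of_real x) p" if "x > 0" for x
    using part[OF assms(1) that] sym[of p] Beta_commute[of p] by simp
  hence "J q p = Beta q p"
    by (intro holomorphic_eq_on_halfplane[OF hol holB, of p p q]) (use assms in simp_all)
  hence "J p q = Beta p q" using sym[of p q] Beta_commute[of p q] by simp
  thus ?thesis by (simp add: J_def)
qed

lemma Gamma_plus_nat: "z \<notin> \<int>\<^sub>\<le>\<^sub>0 \<Longrightarrow> Gamma (z + of_nat n) = pochhammer z n * Gamma (z :: 'a :: Gamma)"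
  by (simp add: pochhammer_Gamma Gamma_eq_zero_iff)

lemma Beta_plus_nat:
  fixes p q :: "'a :: Gamma"
  assumes "p \<notin> \<int>\<^sub>\<le>\<^sub>0" "p + q \<notin> \<int>\<^sub>\<le>\<^sub>0"
  shows "Beta (p + of_nat n) q = Beta p q * (pochhammer p n / pochhammer (p + q) n)"
proof -
  have "Gamma (p + q + of_nat n) = pochhammer (p + q) n * Gamma (p + q)"
    by (rule Gamma_plus_nat[OF assms(2)])
  thus ?thesis
    by (simp add: Beta_def Gamma_plus_nat[OF assms(1)] add.commute add.left_commute mult_ac)
qed

lemma Beta_kernel_mult_power:
  assumes "u \<in> {0<..<1}"
  shows "Beta_kernel p q u * of_real u ^ n = Beta_kernel (p + of_nat n) q u"
    and "Beta_kernel p q u * of_real (1 - u) ^ n = Beta_kernel p (q + of_nat n) u"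
proof -
  have *: "z powr (s - 1) * z ^ n = z powr (s + of_nat n - 1)" if "z \<noteq> 0" for z s :: complex
  proof -
    have "z powr (s + of_nat n - 1) = z powr ((s - 1) + of_nat n)" by (simp add: algebra_simps)
    also have "\<dots> = z powr (s - 1) * z ^ n" using that by (simp add: powr_add powr_nat')
    finally show ?thesis ..
  qed
  have "complex_of_real u \<noteq> 0" "complex_of_real (1 - u) \<noteq> 0"
    using assms by (simp_all only: of_real_eq_0_iff) auto
  from this[THEN *] show "Beta_kernel p q u * of_real u ^ n = Beta_kernel (p + of_nat n) q u"
    and "Beta_kernel p q u * of_real (1 - u) ^ n = Beta_kernel p (q + of_nat n) u"
    unfolding Beta_kernel_def by (simp_all add: mult_ac)
qed

section \<open>The basic integral\<close>

text \<open>The power series stands here in place of \<open>hyp2F1\<close>, so that integrals of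
  this kernel are available for constructing the continuation.\<close>

definition hyp_kernel :: "complex \<Rightarrow> complex \<Rightarrow> complex \<Rightarrow> complex \<Rightarrow> real \<Rightarrow> complex" where
  "hyp_kernel a b c e u = Beta_kernel c e u * eval_fps (fps_hypergeo [a, b] [c] 1) (of_real u)"

lemma hyp_kernel_mult_power:
  "u \<in> {0<..<1} \<Longrightarrow>
     hyp_kernel a b c e u * of_real (1 - u) ^ m = hyp_kernel a b c (e + of_nat m) u"
  unfolding hyp_kernel_def by (simp flip: Beta_kernel_mult_power(2))

text \<open>Termwise integration: the Beta integral contributes
  \<open>pochhammer c n / pochhammer (c + e) n\<close>, which replaces the lower parameter
  \<open>c\<close> by \<open>c + e\<close>, and the remaining series is summed by Gauss's
  theorem.\<close>

lemma
  assumes "Re c > 0" "Re e > 0" "Re (c + e - a - b) > 0"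
  shows set_integrable_hyp_kernel: "set_integrable lborel {0<..<1} (hyp_kernel a b c e)"
    and integral_hyp_kernel: "(LINT u:{0<..<1}|lborel. hyp_kernel a b c e u) =
      Gamma c * Gamma e * Gamma (c + e - a - b) * rGamma (c + e - a) * rGamma (c + e - b)"
proof -
  have c: "c \<notin> \<int>\<^sub>\<le>\<^sub>0" "c + e \<notin> \<int>\<^sub>\<le>\<^sub>0" and e: "e \<notin> \<int>\<^sub>\<le>\<^sub>0"
    using assms by (auto intro!: Re_pos_notin_nonpos_Ints)
  define f where "f = (\<lambda>n u. indicat_real {0<..<1} u *\<^sub>R
    (hyp_coeff a b c n * Beta_kernel (c + of_nat n) e u))"
  have f_sums: "(\<lambda>n. f n u) sums (indicat_real {0<..<1} u *\<^sub>R hyp_kernel a b c e u)"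
    and f_abs: "summable (\<lambda>n. norm (f n u))" for u
  proof -
    have "(\<lambda>n. f n u) sums (indicat_real {0<..<1} u *\<^sub>R hyp_kernel a b c e u) \<and>
          summable (\<lambda>n. norm (f n u))"
    proof (cases "u \<in> {0<..<1}")
      case True
      have eq: "f n u = Beta_kernel c e u * (hyp_coeff a b c n * of_real u ^ n)" for n
        using True by (simp add: f_def mult_ac flip: Beta_kernel_mult_power(1))
      have "norm (complex_of_real u) < 1" using True by simp
      from sums_hypergeo_2F1[OF c(1) this] show ?thesis
        unfolding eq using True
        by (auto simp: hyp_kernel_def norm_mult[of "Beta_kernel _ _ _"] intro!: sums_mult summable_mult)
    qed (simp add: f_def)
    thus "(\<lambda>n. f n u) sums (indicat_real {0<..<1} u *\<^sub>R hyp_kernel a b c e u)"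
      and "summable (\<lambda>n. norm (f n u))" by blast+
  qed
  have f_int: "integrable lborel (f n)" for n
  proof -
    have "set_integrable lborel {0<..<1} (\<lambda>u. hyp_coeff a b c n * Beta_kernel (c + of_nat n) e u)"
      by (intro set_integrable_mult_right set_integrable_Beta_kernel) (use assms in auto)
    thus ?thesis by (simp add: f_def set_integrable_def)
  qed
  have f_norm: "(\<integral>u. norm (f n u) \<partial>lborel) = norm (hyp_coeff a b c n) * Beta (Re c + real n) (Re e)" for n
  proof -
    have "(\<integral>u. norm (f n u) \<partial>lborel) = (LINT u:{0<..<1}|lborel. norm (hyp_coeff a b c n) *
        (u powr (Re c + real n - 1) * (1 - u) powr (Re e - 1)))"
      unfolding set_lebesgue_integral_def
      by (intro Bochner_Integration.integral_cong refl)
         (auto simp: f_def indicator_def norm_mult norm_Beta_kernel)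
    also have "\<dots> = norm (hyp_coeff a b c n) * Beta (Re c + real n) (Re e)"
      using Beta_integral_real[of "Re c + real n" "Re e"] assms by simp
    finally show ?thesis .
  qed
  have summ: "summable (\<lambda>n. \<integral>u. norm (f n u) \<partial>lborel)"
  proof -
    \<comment> \<open>The ratio of Pochhammer symbols in \<open>Beta (Re c + n) (Re e)\<close> is
      itself a hypergeometric coefficient, with second upper parameter 1 to cancel the factorial.
      The coefficient bound thus gives decay of order \<open>- Re e\<close>.\<close>
    define c' e' where "c' = complex_of_real (Re c)" and "e' = complex_of_real (Re e)"
    have c': "c' + e' \<notin> \<int>\<^sub>\<le>\<^sub>0" "c' \<notin> \<int>\<^sub>\<le>\<^sub>0"
      using assms by (auto simp: c'_def e'_def intro!: Re_pos_notin_nonpos_Ints)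
    have B: "Beta (Re c + real n) (Re e) = norm (Beta c' e') * norm (hyp_coeff c' 1 (c' + e') n)" for n
    proof -
      have "Beta (Re c + real n) (Re e) = norm (complex_of_real (Beta (Re c + real n) (Re e)))"
        unfolding norm_of_real
        by (rule abs_of_nonneg[symmetric]) (use assms in \<open>simp add: Beta_def Gamma_real_pos less_imp_le\<close>)
      also have "\<dots> = norm (Beta (c' + of_nat n) e')"
        by (simp add: Beta_complex_of_real[symmetric] c'_def e'_def)
      also have "\<dots> = norm (Beta c' e') * norm (hyp_coeff c' 1 (c' + e') n)"
        using Beta_plus_nat[OF c'(2,1), of n]
        by (simp add: hyp_coeff_def norm_mult norm_divide flip: pochhammer_fact)
      finally show ?thesis .
    qed
    obtain K1 where K1: "K1 > 0" "\<And>n. norm (hyp_coeff a b c n) \<le>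
        K1 * (real n + 1) powr (Re a + Re b - Re c - 1)"
      using hyp_coeff_bound[OF c(1)] by blast
    obtain K2 where K2: "K2 > 0" "\<And>n. norm (hyp_coeff c' 1 (c' + e') n) \<le>
        K2 * (real n + 1) powr (Re c' + Re 1 - Re (c' + e') - 1)"
      using hyp_coeff_bound[OF c'(1)] by blast
    \<comment> \<open>The combined exponent is below -1 precisely by
      \<open>Re (c + e - a - b) > 0\<close>.\<close>
    have "summable (\<lambda>n. K1 * norm (Beta c' e') * K2 * (real n + 1) powr (Re a + Re b - Re c - Re e - 1))"
      by (intro summable_mult summable_Suc_powr) (use assms in simp)
    thus ?thesis
    proof (rule summable_comparison_test')
      fix n
      have "norm (\<integral>u. norm (f n u) \<partial>lborel) = norm (hyp_coeff a b c n) * (norm (Beta c' e') *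
               norm (hyp_coeff c' 1 (c' + e') n))"
        unfolding f_norm B by simp
      also have "\<dots> \<le> (K1 * (real n + 1) powr (Re a + Re b - Re c - 1)) *
         (norm (Beta c' e') * (K2 * (real n + 1) powr (Re c' + Re 1 - Re (c' + e') - 1)))"
        using K1 K2 by (intro mult_mono mult_nonneg_nonneg) auto
      also have "\<dots> = K1 * norm (Beta c' e') * K2 * ((real n + 1) powr (Re a + Re b - Re c - 1) *
          (real n + 1) powr (- Re e))"
        by (simp add: e'_def)
      also have "(real n + 1) powr (Re a + Re b - Re c - 1) * (real n + 1) powr (- Re e) =
          (real n + 1) powr (Re a + Re b - Re c - Re e - 1)"
        by (simp flip: powr_add add: algebra_simps)
      finally show "norm (\<integral>u. norm (f n u) \<partial>lborel) \<le> K1 * norm (Beta c' e') * K2 *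
          (real n + 1) powr (Re a + Re b - Re c - Re e - 1)" .
    qed
  qed
  have f_suminf: "(\<Sum>n. f n u) = indicat_real {0<..<1} u *\<^sub>R hyp_kernel a b c e u" for u
    using f_sums by (rule sums_unique[symmetric])
  show "set_integrable lborel {0<..<1} (hyp_kernel a b c e)"
    using integrable_suminf[OF f_int _ summ] f_abs
    by (simp add: f_suminf set_integrable_def)
  have "(\<lambda>n. \<integral>u. f n u \<partial>lborel) sums (LINT u:{0<..<1}|lborel. hyp_kernel a b c e u)"
    using sums_integral[OF f_int _ summ] f_abs
    by (simp add: f_suminf set_lebesgue_integral_def)
  moreover have "(\<integral>u. f n u \<partial>lborel) = Beta c e * hyp_coeff a b (c + e) n" for n
  proof -
    have "(\<integral>u. f n u \<partial>lborel) = hyp_coeff a b c n * (LINT u:{0<..<1}|lborel. Beta_kernel (c + of_nat n) e u)"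
      unfolding f_def set_lebesgue_integral_def[symmetric] by simp
    also have "\<dots> = hyp_coeff a b c n * (Beta c e * (pochhammer c n / pochhammer (c + e) n))"
      using assms by (simp add: Beta_integral Beta_plus_nat[OF c])
    also have "pochhammer c n \<noteq> 0"
      using c(1) pochhammer_eq_0_imp_nonpos_Int by blast
    hence "hyp_coeff a b c n * (Beta c e * (pochhammer c n / pochhammer (c + e) n)) =
             Beta c e * hyp_coeff a b (c + e) n"
      by (simp add: hyp_coeff_def mult_ac)
    finally show ?thesis .
  qed
  ultimately have "(\<lambda>n. Beta c e * hyp_coeff a b (c + e) n) sums
      (LINT u:{0<..<1}|lborel. hyp_kernel a b c e u)" by simp
  moreover have "(\<lambda>n. Beta c e * hyp_coeff a b (c + e) n) sums (Beta c e * (\<Sum>n. hyp_coeff a b (c + e) n))"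
    using summable_norm_hyp_coeff[OF c(2) assms(3)]
    by (intro sums_mult summable_sums) (rule summable_norm_cancel)
  ultimately have "(LINT u:{0<..<1}|lborel. hyp_kernel a b c e u) = Beta c e * (\<Sum>n. hyp_coeff a b (c + e) n)"
    by (rule sums_unique2)
  also have "\<dots> = Beta c e * Gamma (c + e) * Gamma (c + e - a - b) * rGamma (c + e - a) * rGamma (c + e - b)"
    using assms by (subst Gauss_sum) auto
  also have "Beta c e * Gamma (c + e) = Gamma c * Gamma e"
    using c(2) by (simp add: Beta_def Gamma_eq_zero_iff)
  finally show "(LINT u:{0<..<1}|lborel. hyp_kernel a b c e u) =
      Gamma c * Gamma e * Gamma (c + e - a - b) * rGamma (c + e - a) * rGamma (c + e - b)" .
qed

text \<open>With the parameters \<open>1 1\<close> the coefficient is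
  \<open>pochhammer s n / fact n\<close>; in this form the convergence results for hypergeometric
  series cover the binomial series as well.\<close>

lemma binomial_series_sums:
  assumes "norm z < 1"
  shows "(\<lambda>n. hyp_coeff s 1 1 n * z ^ n) sums ((1 - z) powr (- s))"
  using gen_binomial_complex[of "- z" "- s"] assms
  by (simp add: gbinomial_pochhammer hyp_coeff_def power_minus[of z] mult_ac flip: pochhammer_fact)

text \<open>The exponent is tied to the kernel: \<open>c + e - b\<close> is the argument of an
  \<open>rGamma\<close> factor in the integral of \<open>hyp_kernel a b c e\<close>, which makes the
  expansion in \<open>1 - x\<close> a 2F1. With \<open>c - b\<close> in the role of \<open>b\<close>
  and \<open>e = 1 - b - \<mu>\<close> the exponent becomes \<open>\<mu> - 1\<close>.\<close>

definition hyp_integral :: "complex \<Rightarrow> complex \<Rightarrow> complex \<Rightarrow> complex \<Rightarrow> complex \<Rightarrow> complex" where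
  "hyp_integral a b c e x = (LINT u:{0<..<1}|lborel.
     hyp_kernel a b c e u * (1 - (1 - x) * of_real (1 - u)) powr (- (c + e - b)))"

lemma hyp_integral_eq_series:
  assumes "Re c > 0" "Re e > 0" "Re (c + e - a - b) > 0" "c + e - a \<notin> \<int>\<^sub>\<le>\<^sub>0" "norm (1 - x) < 1"
  shows "hyp_integral a b c e x =
     Gamma c * Gamma e * Gamma (c + e - a - b) * rGamma (c + e - a) * rGamma (c + e - b) *
     eval_fps (fps_hypergeo [e, c + e - a - b] [c + e - a] 1) (1 - x)"
proof -
  define s where "s = c + e - b"
  define K where "K = Gamma c * Gamma e * Gamma (c + e - a - b) * rGamma (c + e - a) * rGamma s"
  define f where "f = (\<lambda>m u. indicat_real {0<..<1} u *\<^sub>R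
     (hyp_kernel a b c e u * (hyp_coeff s 1 1 m * ((1 - x) * of_real (1 - u)) ^ m)))"
  note int = set_integrable_hyp_kernel[OF assms(1-3)]
  \<comment> \<open>The powers of \<open>1 - u\<close> are absorbed by raising \<open>e\<close> to
    \<open>e + m\<close>, so each term is again an integral of the kernel.\<close>
  have f_alt: "f m = (\<lambda>u. indicat_real {0<..<1} u *\<^sub>R
     (hyp_coeff s 1 1 m * (1 - x) ^ m * hyp_kernel a b c (e + of_nat m) u))" for m
    by (auto simp: f_def fun_eq_iff indicator_def power_mult_distrib mult_ac simp flip: hyp_kernel_mult_power)
  have int_m: "set_integrable lborel {0<..<1} (hyp_kernel a b c (e + of_nat m))" for m
    by (rule set_integrable_hyp_kernel) (use assms in auto)
  have f_int: "integrable lborel (f m)" for m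
    unfolding f_alt set_integrable_def[symmetric] by (intro set_integrable_mult_right int_m)
  have le: "norm ((1 - x) * of_real (1 - u)) \<le> norm (1 - x)" if "u \<in> {0<..<1}" for u
    using that mult_left_mono[of "1 - u" 1 "norm (1 - x)"] by (simp add: norm_mult del: of_real_diff)
  have f_le: "norm (f m u) \<le> norm (indicat_real {0<..<1} u *\<^sub>R hyp_kernel a b c e u) *
      norm (hyp_coeff s 1 1 m * (1 - x) ^ m)" for m u
  proof (cases "u \<in> {0<..<1}")
    case True
    have "norm (f m u) = norm (hyp_kernel a b c e u) * (norm (hyp_coeff s 1 1 m) *
        norm ((1 - x) * of_real (1 - u)) ^ m)"
      using True by (simp add: f_def norm_mult norm_power del: of_real_diff)
    also have "\<dots> \<le> norm (hyp_kernel a b c e u) * (norm (hyp_coeff s 1 1 m) * norm (1 - x) ^ m)"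
      by (intro mult_left_mono power_mono le True) auto
    finally show ?thesis using True by (simp add: norm_mult norm_power)
  qed (simp add: f_def)
  have abs: "summable (\<lambda>m. norm (hyp_coeff s 1 1 m * (1 - x) ^ m))"
    by (rule sums_hypergeo_2F1(2)) (use assms(5) Re_pos_notin_nonpos_Ints[of 1] in auto)
  have f_abs: "summable (\<lambda>m. norm (f m u))" for u
    by (rule summable_comparison_test'[OF summable_mult[OF abs]]) (use f_le in auto)
  have f_sum: "(\<Sum>m. f m u) = indicat_real {0<..<1} u *\<^sub>R
      (hyp_kernel a b c e u * (1 - (1 - x) * of_real (1 - u)) powr (- s))" for u
  proof (cases "u \<in> {0<..<1}")
    case True
    have "(\<lambda>m. f m u) sums (hyp_kernel a b c e u * (1 - (1 - x) * of_real (1 - u)) powr (- s))"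
      unfolding f_def using True le[OF True] assms(5)
      by (simp only: indicator_simps scaleR_one) (intro sums_mult binomial_series_sums, simp)
    thus ?thesis using True by (simp add: sums_iff)
  qed (simp add: f_def)
  have summ: "summable (\<lambda>m. \<integral>u. norm (f m u) \<partial>lborel)"
  proof (rule summable_comparison_test'[OF summable_mult[OF abs]])
    fix m
    have "(\<integral>u. norm (f m u) \<partial>lborel) \<le> (\<integral>u. norm (indicat_real {0<..<1} u *\<^sub>R hyp_kernel a b c e u) *
      norm (hyp_coeff s 1 1 m * (1 - x) ^ m) \<partial>lborel)"
      using int f_int[of m] unfolding set_integrable_def
      by (intro integral_mono f_le integrable_mult_left integrable_norm)
    thus "norm (\<integral>u. norm (f m u) \<partial>lborel) \<le>
        (\<integral>u. norm (indicat_real {0<..<1} u *\<^sub>R hyp_kernel a b c e u) \<partial>lborel) *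
         norm (hyp_coeff s 1 1 m * (1 - x) ^ m)"
      by simp
  qed
  have "(\<lambda>m. \<integral>u. f m u \<partial>lborel) sums hyp_integral a b c e x"
    using sums_integral[OF f_int _ summ] f_abs
    by (simp add: f_sum set_lebesgue_integral_def hyp_integral_def s_def)
  moreover have "(\<integral>u. f m u \<partial>lborel) =
      K * (hyp_coeff e (c + e - a - b) (c + e - a) m * (1 - x) ^ m)" for m
  proof -
    define G where "G = Gamma c * Gamma (e + of_nat m) * Gamma ((c + e - a - b) + of_nat m) *
        rGamma ((c + e - a) + of_nat m) * rGamma (s + of_nat m)"
    have "(\<integral>u. f m u \<partial>lborel) = hyp_coeff s 1 1 m * (1 - x) ^ m *
        (LINT u:{0<..<1}|lborel. hyp_kernel a b c (e + of_nat m) u)"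
      unfolding f_alt set_lebesgue_integral_def[symmetric] by simp
    also have "(LINT u:{0<..<1}|lborel. hyp_kernel a b c (e + of_nat m) u) = G"
      by (subst integral_hyp_kernel) (use assms in \<open>auto simp: algebra_simps s_def G_def\<close>)
    also have "hyp_coeff s 1 1 m * (1 - x) ^ m * G =
       K * (hyp_coeff e (c + e - a - b) (c + e - a) m * (1 - x) ^ m)"
    proof -
      have "e \<notin> \<int>\<^sub>\<le>\<^sub>0" "c + e - a - b \<notin> \<int>\<^sub>\<le>\<^sub>0"
        using assms by (auto intro!: Re_pos_notin_nonpos_Ints)
      from this[THEN Gamma_plus_nat, of m] have
        *: "Gamma (e + of_nat m) = pochhammer e m * Gamma e"
           "Gamma (c + e - a - b + of_nat m) = pochhammer (c + e - a - b) m * Gamma (c + e - a - b)" .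
      \<comment> \<open>The factor \<open>pochhammer s m\<close> is cancelled through
        \<open>rGamma\<close> rather than through \<open>Gamma\<close>, which is valid also when
        \<open>s\<close> is a pole of \<open>Gamma\<close>, as happens for
        \<open>s = 1 - \<mu>\<close> with \<open>\<mu>\<close> a positive integer.\<close>
      have "pochhammer (c + e - a) m \<noteq> 0"
        using assms(4) pochhammer_eq_0_imp_nonpos_Int by blast
      thus ?thesis
        unfolding G_def K_def * pochhammer_rGamma[of "c + e - a" m] pochhammer_rGamma[of s m] hyp_coeff_def
        by (simp add: field_simps flip: pochhammer_fact)
    qed
    finally show ?thesis .
  qed
  ultimately have "(\<lambda>m. K * (hyp_coeff e (c + e - a - b) (c + e - a) m * (1 - x) ^ m)) sums
      hyp_integral a b c e x" by simp
  moreover have "(\<lambda>m. K * (hyp_coeff e (c + e - a - b) (c + e - a) m * (1 - x) ^ m)) sums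
      (K * eval_fps (fps_hypergeo [e, c + e - a - b] [c + e - a] 1) (1 - x))"
    by (intro sums_mult sums_hypergeo_2F1 assms)
  ultimately show ?thesis
    unfolding K_def s_def by (rule sums_unique2)
qed

section \<open>Domination and holomorphy of the basic integral in \<open>x\<close>\<close>

lemma continuous_on_powr_complex_const:
  fixes f :: "'a :: topological_space \<Rightarrow> complex"
  assumes "continuous_on A f" "\<And>x. x \<in> A \<Longrightarrow> f x \<notin> \<real>\<^sub>\<le>\<^sub>0"
  shows "continuous_on A (\<lambda>x. f x powr s)"
proof (rule continuous_on_powr_complex)
  show "A \<subseteq> {z. 0 \<le> Re (f z) \<or> Im (f z) \<noteq> 0}"
    using assms(2) by (force simp: complex_nonpos_Reals_iff)
  show "0 < Re s" if "x \<in> A" "f x = 0" for x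
    using assms(2)[OF that(1)] that(2) by simp
qed (use assms in auto)

text \<open>The expression runs through the segment from \<open>x\<close> to 1, and the plane slit
  along the nonpositive reals is starlike about 1.\<close>

lemma segment_one_avoids_nonpos_Reals:
  fixes x :: complex
  assumes "x \<notin> \<real>\<^sub>\<le>\<^sub>0" "u \<in> {0..1}"
  shows "1 - (1 - x) * of_real (1 - u) \<notin> \<real>\<^sub>\<le>\<^sub>0"
proof
  assume "1 - (1 - x) * of_real (1 - u) \<in> \<real>\<^sub>\<le>\<^sub>0"
  hence *: "1 - (1 - Re x) * (1 - u) \<le> 0" "Im x * (1 - u) = 0"
    by (auto simp: complex_nonpos_Reals_iff)
  hence "u \<noteq> 1" by auto
  hence "Im x = 0" using * by simp
  hence "Re x > 0" using assms(1) by (auto simp: complex_nonpos_Reals_iff)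
  hence "Re x * (1 - u) + u > 0"
    using assms(2) \<open>u \<noteq> 1\<close> by (intro add_pos_nonneg mult_pos_pos) auto
  thus False using * by (simp add: algebra_simps)
qed

text \<open>Closing the interval makes \<open>X \<times> {0..1}\<close> compact, and the power is
  still continuous there. The bound is uniform in \<open>x\<close>, as differentiation under the
  integral requires.\<close>

lemma hyp_integral_powr_bound:
  fixes X :: "complex set"
  assumes "X \<subseteq> - \<real>\<^sub>\<le>\<^sub>0" "compact X"
  obtains B where "\<And>x u. x \<in> X \<Longrightarrow> u \<in> {0<..<1} \<Longrightarrow>
    norm ((1 - (1 - x) * of_real (1 - u)) powr s) \<le> B"
proof -
  let ?h = "\<lambda>(x, u). (1 - (1 - x) * of_real (1 - u)) powr s"
  have "continuous_on (X \<times> {0..1}) ?h"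
    unfolding case_prod_unfold using segment_one_avoids_nonpos_Reals assms(1)
    by (intro continuous_on_powr_complex_const continuous_intros) auto
  hence "compact (?h ` (X \<times> {0..1}))"
    by (intro compact_continuous_image compact_Times assms compact_Icc)
  hence "bounded (?h ` (X \<times> {0..1}))" by (rule compact_imp_bounded)
  then obtain B where "\<And>y. y \<in> ?h ` (X \<times> {0..1}) \<Longrightarrow> norm y \<le> B"
    unfolding bounded_iff by blast
  hence "norm (?h (x, u)) \<le> B" if "x \<in> X" "u \<in> {0<..<1}" for x u
    using that by (metis (no_types, lifting) SigmaI greaterThanLessThan_subseteq_atLeastAtMost_iff imageI order_refl subsetD)
  thus thesis by (intro that) auto
qed

lemma set_borel_measurable_hyp_integrand:
  assumes "Re c > 0" "Re e > 0" "Re (c + e - a - b) > 0" "x \<notin> \<real>\<^sub>\<le>\<^sub>0"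
  shows "set_borel_measurable lborel {0<..<1}
           (\<lambda>u. hyp_kernel a b c e u * (1 - (1 - x) * of_real (1 - u)) powr s)"
proof -
  have "continuous_on {0<..<1::real} (\<lambda>u. (1 - (1 - x) * of_real (1 - u)) powr s)"
    using segment_one_avoids_nonpos_Reals[OF assms(4)]
    by (intro continuous_on_powr_complex_const continuous_intros) auto
  hence "set_borel_measurable lborel {0<..<1} (\<lambda>u. (1 - (1 - x) * of_real (1 - u)) powr s)"
    by (rule set_borel_measurable_lborel_continuous) simp
  moreover have "set_borel_measurable lborel {0<..<1} (hyp_kernel a b c e)"
    using set_integrable_hyp_kernel[OF assms(1-3)]
    by (auto simp: set_integrable_def set_borel_measurable_def)
  ultimately have "(\<lambda>u. (indicat_real {0<..<1} u *\<^sub>R hyp_kernel a b c e u) *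
     (indicat_real {0<..<1} u *\<^sub>R (1 - (1 - x) * of_real (1 - u)) powr s)) \<in> borel_measurable lborel"
    unfolding set_borel_measurable_def by (rule borel_measurable_times[rotated])
  thus ?thesis
    unfolding set_borel_measurable_def
    by (rule measurable_cong[THEN iffD1, rotated]) (auto simp: indicator_def)
qed

lemma set_integrable_hyp_integrand:
  assumes "Re c > 0" "Re e > 0" "Re (c + e - a - b) > 0" "x \<notin> \<real>\<^sub>\<le>\<^sub>0"
  shows "set_integrable lborel {0<..<1}
           (\<lambda>u. hyp_kernel a b c e u * (1 - (1 - x) * of_real (1 - u)) powr s)"
proof -
  obtain B where B: "\<And>z u. z \<in> {x} \<Longrightarrow> u \<in> {0<..<1} \<Longrightarrow>
      norm ((1 - (1 - z) * of_real (1 - u)) powr s) \<le> B"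
    by (rule hyp_integral_powr_bound[of "{x}" s]) (use assms(4) in auto)
  have "set_integrable lborel {0<..<1} (\<lambda>u. of_real B * hyp_kernel a b c e u)"
    using set_integrable_hyp_kernel[OF assms(1-3)] by simp
  thus ?thesis
  proof (rule set_integrable_bound)
    have "norm (hyp_kernel a b c e u) * norm ((1 - (1 - x) * of_real (1 - u)) powr s) \<le>
        norm (hyp_kernel a b c e u) * norm B" if "u \<in> {0<..<1}" for u
      using B[OF singletonI that] by (intro mult_left_mono) auto
    thus "AE u in lborel. u \<in> {0<..<1} \<longrightarrow>
        norm (hyp_kernel a b c e u * (1 - (1 - x) * of_real (1 - u)) powr s) \<le>
        norm (of_real B * hyp_kernel a b c e u)"
      by (intro AE_I2) (simp add: norm_mult mult.commute)
  qed (rule set_borel_measurable_hyp_integrand[OF assms])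
qed

lemma holomorphic_hyp_integral:
  assumes "Re c > 0" "Re e > 0" "Re (c + e - a - b) > 0"
  shows "hyp_integral a b c e holomorphic_on (- \<real>\<^sub>\<le>\<^sub>0)"
  unfolding hyp_integral_def[abs_def] set_lebesgue_integral_def
proof (rule holomorphic_on_Bochner_integral)
  show "open (- \<real>\<^sub>\<le>\<^sub>0 :: complex set)" by (simp add: open_Compl)
next
  fix x :: complex assume x: "x \<in> - \<real>\<^sub>\<le>\<^sub>0"
  let ?f = "\<lambda>x u. indicat_real {0<..<1} u *\<^sub>R
     (hyp_kernel a b c e u * (1 - (1 - x) * of_real (1 - u)) powr (- (c + e - b)))"
  show "?f x \<in> borel_measurable lborel"
    using set_borel_measurable_hyp_integrand[OF assms, of x] x by (simp add: set_borel_measurable_def)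
  obtain r where r: "r > 0" "cball x r \<subseteq> - \<real>\<^sub>\<le>\<^sub>0"
    using x open_contains_cball[of "- \<real>\<^sub>\<le>\<^sub>0 :: complex set"] by (auto simp: open_Compl)
  obtain B where B: "\<And>z u. z \<in> cball x r \<Longrightarrow> u \<in> {0<..<1} \<Longrightarrow>
      norm ((1 - (1 - z) * of_real (1 - u)) powr (- (c + e - b))) \<le> B"
    using hyp_integral_powr_bound[OF r(2) compact_cball] by blast
  let ?g = "\<lambda>u. norm (indicat_real {0<..<1} u *\<^sub>R hyp_kernel a b c e u) * B"
  have "integrable lborel ?g"
    using set_integrable_hyp_kernel[OF assms] unfolding set_integrable_def
    by (intro integrable_mult_left integrable_norm)
  moreover have "norm (?f z u) \<le> ?g u" if "z \<in> cball x r" for z u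
    using B[OF that, of u] by (auto simp: indicator_def norm_mult intro!: mult_left_mono)
  ultimately show "\<exists>r>0. \<exists>g. cball x r \<subseteq> - \<real>\<^sub>\<le>\<^sub>0 \<and> integrable lborel g \<and>
      (\<forall>z\<in>cball x r. \<forall>u\<in>space lborel. norm (?f z u) \<le> g u)"
    using r by blast
next
  fix u :: real
  have "(\<lambda>x. hyp_kernel a b c e u * (1 - (1 - x) * of_real (1 - u)) powr (- (c + e - b)))
      holomorphic_on - \<real>\<^sub>\<le>\<^sub>0" if "u \<in> {0<..<1}"
    using segment_one_avoids_nonpos_Reals[of _ u] that by (intro holomorphic_intros) auto
  thus "(\<lambda>x. indicat_real {0<..<1} u *\<^sub>R
     (hyp_kernel a b c e u * (1 - (1 - x) * of_real (1 - u)) powr (- (c + e - b)))) holomorphic_on - \<real>\<^sub>\<le>\<^sub>0"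
    by (cases "u \<in> {0<..<1}") simp_all
qed

section \<open>Analytic continuation\<close>

abbreviation slit_plane :: "complex set" where
  "slit_plane \<equiv> - complex_of_real ` {1..}"

lemma slit_plane_iff: "z \<in> slit_plane \<longleftrightarrow> 1 - z \<notin> \<real>\<^sub>\<le>\<^sub>0"
proof -
  have "z \<in> complex_of_real ` {1..} \<longleftrightarrow> Im z = 0 \<and> Re z \<ge> 1"
  proof safe
    assume "Im z = 0" "Re z \<ge> 1"
    moreover from this have "z = of_real (Re z)" by (simp add: complex_eq_iff)
    ultimately show "z \<in> complex_of_real ` {1..}" by (metis atLeast_iff imageI)
  qed auto
  thus ?thesis by (auto simp: complex_nonpos_Reals_iff)
qed

lemma slit_plane_eq: "slit_plane = {z. 1 - z \<notin> \<real>\<^sub>\<le>\<^sub>0}"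
  by (rule set_eqI) (simp only: slit_plane_iff mem_Collect_eq)

lemma open_slit_plane: "open slit_plane"
proof -
  have "slit_plane = (\<lambda>z. 1 - z) -` (- \<real>\<^sub>\<le>\<^sub>0)"
    unfolding slit_plane_eq by auto
  also have "open \<dots>"
    by (intro open_vimage open_Compl closed_nonpos_Reals_complex continuous_intros)
  finally show ?thesis .
qed

lemma ball_subset_slit_plane: "ball 0 1 \<subseteq> slit_plane"
  by auto

text \<open>If a contraction \<open>t * z\<close> towards 0 lies on the slit, then \<open>z\<close>
  is real and at least as large, hence on the slit too. Starlikeness serves twice: it gives
  connectedness for the identity theorem, and primitives of holomorphic functions.\<close>

lemma starlike_slit_plane: "starlike slit_plane"
  unfolding starlike_def
proof (intro bexI ballI subsetI)
  fix z w :: complex assume z: "z \<in> slit_plane" and w: "w \<in> closed_segment 0 z"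
  obtain t where t: "0 \<le> t" "t \<le> 1" "w = of_real t * z"
    using w by (auto simp: closed_segment_def scaleR_conv_of_real)
  show "w \<in> slit_plane"
  proof (rule ccontr)
    assume "w \<notin> slit_plane"
    hence "1 - w \<in> \<real>\<^sub>\<le>\<^sub>0" unfolding slit_plane_iff by simp
    hence *: "1 - t * Re z \<le> 0" "t * Im z = 0"
      by (simp_all add: complex_nonpos_Reals_iff t(3))
    hence "t > 0" using t by (cases "t = 0") auto
    have "Re z > 0"
    proof (rule ccontr)
      assume "\<not> Re z > 0"
      hence "t * Re z \<le> 0" using t by (intro mult_nonneg_nonpos) auto
      thus False using * by simp
    qed
    hence "t * Re z \<le> 1 * Re z" using t by (intro mult_right_mono) auto
    hence "1 - z \<in> \<real>\<^sub>\<le>\<^sub>0" using * \<open>t > 0\<close> by (auto simp: complex_nonpos_Reals_iff)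
    thus False using z slit_plane_iff by blast
  qed
next
  show "0 \<in> slit_plane" by auto
qed

lemma connected_slit_plane: "connected slit_plane"
  by (rule starlike_imp_connected[OF starlike_slit_plane])

text \<open>The radius is left free because the series form of Pfaff's transformation is established
  only for \<open>norm z < 1 / 2\<close>.\<close>

lemma holomorphic_eq_on_slit_plane:
  assumes "f holomorphic_on slit_plane" "g holomorphic_on slit_plane" "r > 0" "r \<le> 1"
    and "\<And>z. norm z < r \<Longrightarrow> f z = g z" "z \<in> slit_plane"
  shows "f z = g z"
proof (rule analytic_continuation_open[of "ball 0 r" slit_plane f g])
  have "ball 0 r \<subseteq> ball (0::complex) 1" using assms(4) by auto
  thus "ball 0 r \<subseteq> slit_plane" using ball_subset_slit_plane by blast
qed (use assms(1,2,3,5,6) in \<open>simp_all add: open_slit_plane connected_slit_plane del: Compl_iff\<close>)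

lemma plus1_notin_nonpos_Ints: "z \<notin> \<int>\<^sub>\<le>\<^sub>0 \<Longrightarrow> z + 1 \<notin> \<int>\<^sub>\<le>\<^sub>0"
  using plus_one_in_nonpos_Ints_imp by blast

section \<open>Existence of the continuation\<close>

lemma fps_deriv_hypergeo_2F1:
  fixes a b c :: complex
  shows "fps_deriv (fps_hypergeo [a, b] [c] 1) =
    fps_const (a * b / c) * fps_hypergeo [a + 1, b + 1] [c + 1] 1"
proof (rule fps_ext)
  fix n
  have "of_nat (Suc n) * hyp_coeff a b c (Suc n) = a * b / c * hyp_coeff (a + 1) (b + 1) (c + 1) n"
    by (simp add: hyp_coeff_def pochhammer_rec divide_simps del: of_nat_Suc)
  thus "fps_nth (fps_deriv (fps_hypergeo [a, b] [c] 1)) n =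
      fps_nth (fps_const (a * b / c) * fps_hypergeo [a + 1, b + 1] [c + 1] 1) n"
    by (simp add: fps_nth_hypergeo_2F1 del: fps_hypergeo_nth of_nat_Suc)
qed

lemma has_field_derivative_hypergeo_2F1:
  fixes a b c z :: complex
  assumes "c \<notin> \<int>\<^sub>\<le>\<^sub>0" "norm z < 1"
  shows "(eval_fps (fps_hypergeo [a, b] [c] 1) has_field_derivative
     a * b / c * eval_fps (fps_hypergeo [a + 1, b + 1] [c + 1] 1) z) (at z)"
proof -
  have z: "ereal (norm z) < 1" using assms(2) by simp
  note r = less_le_trans[OF z fps_conv_radius_hypergeo_2F1]
  note r1 = r[OF assms(1), of a b]
  note r2 = r[OF plus1_notin_nonpos_Ints[OF assms(1)], of "a + 1" "b + 1"]
  show ?thesis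
    using has_field_derivative_eval_fps[OF r1, of UNIV]
    by (simp add: fps_deriv_hypergeo_2F1 eval_fps_mult r2)
qed

lemma hyp_continuation_exists_pos:
  assumes "Re a > 0" "Re b > 0" "c \<notin> \<int>\<^sub>\<le>\<^sub>0"
  shows "\<exists>f. f holomorphic_on slit_plane \<and>
          (\<forall>z. norm z < 1 \<longrightarrow> f z = eval_fps (fps_hypergeo [a, b] [c] 1) z)"
proof -
  \<comment> \<open>\<open>hyp_integral (q + a - c) (c - b) q a\<close> is \<open>K\<close> times the desired function, and \<open>K \<noteq> 0\<close> for \<open>q\<close> large\<close>
  define q where "q = complex_of_real (1 + \<bar>Re c\<bar>)"
  define K where "K = Gamma q * Gamma a * Gamma b * rGamma c * rGamma (q + a - (c - b))"
  define I where "I = hyp_integral (q + a - c) (c - b) q a"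
  \<comment> \<open>The parameters solve the equations that make the resulting 2F1 have upper
    parameters \<open>a\<close>, \<open>b\<close> and lower parameter \<open>c\<close>; one degree
    of freedom, \<open>q\<close>, remains.\<close>
  have eqs: "q + a - (q + a - c) - (c - b) = b" "q + a - (q + a - c) = c" by simp_all
  have q: "Re q > 0" "Re (q + a - (c - b)) > 0"
    using assms by (auto simp: q_def)
  have hyps: "Re q > 0" "Re a > 0" "Re (q + a - (q + a - c) - (c - b)) > 0"
    using assms q unfolding eqs by auto
  have nz: "K \<noteq> 0"
    using assms q Re_pos_notin_nonpos_Ints by (auto simp: K_def Gamma_eq_zero_iff rGamma_eq_zero_iff)
  have "(\<lambda>z. I (1 - z)) holomorphic_on slit_plane"
    by (rule holomorphic_on_compose_gen[OF _ holomorphic_hyp_integral[OF hyps],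
          of "\<lambda>z. 1 - z", unfolded o_def, folded I_def])
       (unfold slit_plane_eq, auto intro!: holomorphic_intros)
  moreover have "I (1 - z) = K * eval_fps (fps_hypergeo [a, b] [c] 1) z" if "norm z < 1" for z
    unfolding I_def K_def
    by (subst hyp_integral_eq_series[OF hyps]) (use that assms(3) in \<open>simp_all add: eqs del: Gamma_eq_zero_iff\<close>)
  ultimately show ?thesis using nz
    by (intro exI[of _ "\<lambda>z. I (1 - z) / K"]) (auto intro!: holomorphic_intros)
qed

lemma hyp_continuation_exists:
  assumes "c \<notin> \<int>\<^sub>\<le>\<^sub>0"
  shows "\<exists>f. f holomorphic_on slit_plane \<and>
          (\<forall>z. norm z < 1 \<longrightarrow> f z = eval_fps (fps_hypergeo [a, b] [c] 1) z)"
proof -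
  have shifted: "\<exists>f. f holomorphic_on slit_plane \<and>
          (\<forall>z. norm z < 1 \<longrightarrow> f z = eval_fps (fps_hypergeo [a, b] [c] 1) z)"
    if "Re a + real n > 0" "Re b + real n > 0" "c \<notin> \<int>\<^sub>\<le>\<^sub>0" for n a b c
    using that
  proof (induction n arbitrary: a b c)
    case 0
    thus ?case by (intro hyp_continuation_exists_pos) auto
  next
    case (Suc n)
    have "\<exists>f. f holomorphic_on slit_plane \<and>
          (\<forall>z. norm z < 1 \<longrightarrow> f z = eval_fps (fps_hypergeo [a + 1, b + 1] [c + 1] 1) z)"
      using Suc.prems by (intro Suc.IH plus1_notin_nonpos_Ints) auto
    then obtain f where f: "f holomorphic_on slit_plane"
      "\<And>z. norm z < 1 \<Longrightarrow> f z = eval_fps (fps_hypergeo [a + 1, b + 1] [c + 1] 1) z" by blast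
    have "\<exists>g. \<forall>z\<in>slit_plane. (g has_field_derivative f z) (at z)"
    proof (rule holomorphic_starlike_primitive[of slit_plane f "{}"])
      show "continuous_on slit_plane f" using f(1) by (rule holomorphic_on_imp_continuous_on)
      show "f field_differentiable at z" if "z \<in> slit_plane - {}" for z
        using that holomorphic_on_imp_differentiable_at[OF f(1) open_slit_plane] by simp
    qed (simp_all add: starlike_slit_plane open_slit_plane)
    then obtain g where g: "\<And>z. z \<in> slit_plane \<Longrightarrow> (g has_field_derivative f z) (at z)" by blast
    \<comment> \<open>The constant of integration is fixed by \<open>h 0 = 1\<close>, the value of
      the series at 0.\<close>
    define h where "h = (\<lambda>z. 1 + a * b / c * (g z - g 0))"
    have h: "(h has_field_derivative a * b / c * f z) (at z)" if "z \<in> slit_plane" for z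
      unfolding h_def by (rule derivative_eq_intros g[OF that] refl)+ simp
    have "h z = eval_fps (fps_hypergeo [a, b] [c] 1) z" if "norm z < 1" for z
    proof -
      have "\<exists>k. \<forall>z\<in>ball 0 1. h z - eval_fps (fps_hypergeo [a, b] [c] 1) z = k"
      proof (rule has_field_derivative_zero_constant)
        fix z :: complex assume z: "z \<in> ball 0 1"
        hence "z \<in> slit_plane" using ball_subset_slit_plane by blast
        hence "((\<lambda>z. h z - eval_fps (fps_hypergeo [a, b] [c] 1) z) has_field_derivative
            (a * b / c * f z - a * b / c * eval_fps (fps_hypergeo [a + 1, b + 1] [c + 1] 1) z)) (at z)"
          using z Suc.prems by (intro DERIV_diff h has_field_derivative_hypergeo_2F1) auto
        thus "((\<lambda>z. h z - eval_fps (fps_hypergeo [a, b] [c] 1) z) has_field_derivative 0)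
                 (at z within ball 0 1)"
          using z f(2)[of z] by (auto intro: has_field_derivative_at_within)
      qed simp
      then obtain k where "\<And>z. norm z < 1 \<Longrightarrow> h z - eval_fps (fps_hypergeo [a, b] [c] 1) z = k" by auto
      from this[of 0] this[OF that] show ?thesis
        by (simp add: h_def eval_fps_at_0)
    qed
    moreover have "h holomorphic_on slit_plane"
      unfolding holomorphic_on_open[OF open_slit_plane] using h by blast
    ultimately show ?case by blast
  qed
  obtain n :: nat where "real n > max (- Re a) (- Re b)"
    using reals_Archimedean2 by blast
  thus ?thesis using assms by (intro shifted[of a n]) auto
qed

lemma
  assumes "c \<notin> \<int>\<^sub>\<le>\<^sub>0"
  shows holomorphic_hyp2F1: "hyp2F1 a b c holomorphic_on slit_plane"
    and hyp2F1_eq_series: "norm z < 1 \<Longrightarrow> hyp2F1 a b c z = eval_fps (fps_hypergeo [a, b] [c] 1) z"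
  using someI_ex[OF hyp_continuation_exists[OF assms, of a b]] unfolding hyp2F1_def by auto

lemma hyp2F1_commute: "hyp2F1 a b c = hyp2F1 b a c"
proof -
  have "fps_hypergeo [a, b] [c] 1 = fps_hypergeo [b, a] [c] 1"
    by (simp add: fps_eq_iff mult_ac)
  thus ?thesis by (simp add: hyp2F1_def)
qed

lemma hyp_integral_eq_hyp2F1:
  assumes "Re c > 0" "Re e > 0" "Re (c + e - a - b) > 0" "c + e - a \<notin> \<int>\<^sub>\<le>\<^sub>0" "x \<notin> \<real>\<^sub>\<le>\<^sub>0"
  shows "hyp_integral a b c e x =
     Gamma c * Gamma e * Gamma (c + e - a - b) * rGamma (c + e - a) * rGamma (c + e - b) *
     hyp2F1 e (c + e - a - b) (c + e - a) (1 - x)"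
proof -
  let ?K = "Gamma c * Gamma e * Gamma (c + e - a - b) * rGamma (c + e - a) * rGamma (c + e - b)"
  have "hyp_integral a b c e (1 - (1 - x)) = ?K * hyp2F1 e (c + e - a - b) (c + e - a) (1 - x)"
  proof (rule holomorphic_eq_on_slit_plane[of "\<lambda>z. hyp_integral a b c e (1 - z)"
             "\<lambda>z. ?K * hyp2F1 e (c + e - a - b) (c + e - a) z" 1])
    show "(\<lambda>z. hyp_integral a b c e (1 - z)) holomorphic_on slit_plane"
      by (rule holomorphic_on_compose_gen[OF _ holomorphic_hyp_integral[OF assms(1-3)],
            of "\<lambda>z. 1 - z", unfolded o_def])
         (unfold slit_plane_eq, auto intro!: holomorphic_intros)
    show "(\<lambda>z. ?K * hyp2F1 e (c + e - a - b) (c + e - a) z) holomorphic_on slit_plane"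
      by (intro holomorphic_intros holomorphic_hyp2F1 assms)
    show "1 - x \<in> slit_plane" using assms(5) unfolding slit_plane_eq by simp
    fix z :: complex assume "norm z < 1"
    thus "hyp_integral a b c e (1 - z) = ?K * hyp2F1 e (c + e - a - b) (c + e - a) z"
      using hyp_integral_eq_series[OF assms(1-4), of "1 - z"] hyp2F1_eq_series[OF assms(4)] by simp
  qed simp_all
  thus ?thesis by simp
qed

section \<open>The transformations of Pfaff and Euler\<close>

lemma binomial_series_sums_real:
  assumes "0 \<le> r" "r < (1::real)"
  shows "(\<lambda>n. pochhammer s n / fact n * r ^ n) sums ((1 - r) powr (- s))"
proof -
  have "(\<lambda>n. complex_of_real (pochhammer s n / fact n * r ^ n)) sums of_real ((1 - r) powr (- s))"
    using binomial_series_sums[of "of_real r" "of_real s"] assms powr_of_real[of "1 - r" "- s"]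
    by (simp add: hyp_coeff_def pochhammer_of_real flip: pochhammer_fact)
  thus ?thesis unfolding sums_of_real_iff .
qed

lemma norm_pochhammer_le: "norm z \<le> s \<Longrightarrow> norm (pochhammer (z :: complex) n) \<le> pochhammer s n"
  unfolding pochhammer_prod prod_norm[symmetric]
  by (intro prod_mono) (auto intro: order_trans[OF norm_triangle_ineq])

lemma pochhammer_minus_of_nat:
  assumes "k \<le> n"
  shows "pochhammer (- of_nat n :: complex) k = (- 1) ^ k * fact n / fact (n - k)"
proof -
  have "(of_nat n gchoose k :: complex) = fact n / (fact k * fact (n - k))"
    using assms by (simp add: binomial_fact flip: binomial_gbinomial)
  hence "(- 1) ^ k * ((- 1) ^ k * pochhammer (- of_nat n :: complex) k / fact k) =
      (- 1) ^ k * (fact n / (fact k * fact (n - k)))"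
    by (simp add: gbinomial_pochhammer)
  thus ?thesis by (simp add: field_simps flip: power_add mult_2)
qed

text \<open>Coefficient comparison for Pfaff's transformation. Splitting
  \<open>pochhammer a n\<close> at \<open>k\<close> and writing the factorials through
  \<open>pochhammer (- of_nat n) k\<close> leaves the terminating series
  \<open>F(c-b,-n;c;1)\<close>, which the Chu-Vandermonde identity sums.\<close>

lemma Pfaff_coeff:
  assumes "c \<notin> \<int>\<^sub>\<le>\<^sub>0"
  shows "(\<Sum>k\<le>n. hyp_coeff a (c - b) c k * (- 1) ^ k * hyp_coeff (a + of_nat k) 1 1 (n - k)) =
     hyp_coeff a b c n"
proof -
  have "(\<Sum>k\<le>n. hyp_coeff a (c - b) c k * (- 1) ^ k * hyp_coeff (a + of_nat k) 1 1 (n - k)) =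
        (\<Sum>k\<le>n. pochhammer a n / fact n *
           (pochhammer (c - b) k * pochhammer (- of_nat n) k / (of_nat (fact k) * pochhammer c k)))"
  proof (intro sum.cong refl)
    fix k assume "k \<in> {..n}"
    hence k: "k \<le> n" by simp
    have "pochhammer a n = pochhammer a k * pochhammer (a + of_nat k) (n - k)"
      using pochhammer_product[OF k] .
    thus "hyp_coeff a (c - b) c k * (- 1) ^ k * hyp_coeff (a + of_nat k) 1 1 (n - k) =
        pochhammer a n / fact n *
           (pochhammer (c - b) k * pochhammer (- of_nat n) k / (of_nat (fact k) * pochhammer c k))"
      unfolding pochhammer_minus_of_nat[OF k]
      by (simp add: hyp_coeff_def mult_ac flip: pochhammer_fact)
  qed
  also have "\<dots> = pochhammer a n / fact n * (pochhammer b n / pochhammer c n)"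
  proof -
    have "\<forall>i\<in>{0..<n}. c \<noteq> - of_nat i" using assms by auto
    from Vandermonde_pochhammer[OF this, of "c - b"] show ?thesis
      unfolding sum_distrib_left[symmetric] by (simp add: atLeast0AtMost)
  qed
  also have "\<dots> = hyp_coeff a b c n" by (simp add: hyp_coeff_def mult_ac)
  finally show ?thesis .
qed

text \<open>Expand each power of \<open>z / (z - 1)\<close> times \<open>(1 - z) powr (- a)\<close>
  binomially and collect powers of \<open>z\<close>. Absolute convergence of the double series is
  governed by \<open>norm z / (1 - norm z)\<close>, which is below 1 exactly for
  \<open>norm z < 1 / 2\<close>.\<close>

lemma Pfaff_series:
  fixes a b c z :: complex
  assumes c: "c \<notin> \<int>\<^sub>\<le>\<^sub>0" and z: "norm z < 1 / 2"
  shows "eval_fps (fps_hypergeo [a, b] [c] 1) z =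
    (1 - z) powr (- a) * eval_fps (fps_hypergeo [a, c - b] [c] 1) (z / (z - 1))"
proof -
  define C where "C = hyp_coeff a (c - b) c"
  define T where "T = (\<lambda>(k, m). C k * (- 1) ^ k * hyp_coeff (a + of_nat k) 1 1 m * z ^ (k + m))"
  \<comment> \<open>Majorant with \<open>a\<close> replaced by \<open>norm a\<close>: its inner sum
    over \<open>m\<close> is again a binomial series, now with nonnegative terms.\<close>
  define g where "g = (\<lambda>(k, m). norm (C k) * norm z ^ k *
     (pochhammer (norm a + real k) m / fact m * norm z ^ m))"
  define q where "q = norm z / (1 - norm z)"
  have z1: "norm z < 1" "z \<noteq> 1" and q: "0 \<le> q" "q < 1" using z by (auto simp: q_def field_simps)
  have pos: "pochhammer (norm a + real k) m \<ge> 0" for k m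
    by (rule order_trans[OF norm_ge_zero norm_pochhammer_le[of 0]]) simp
  have "g summable_on (UNIV \<times> UNIV)"
  proof (rule summable_on_SigmaI)
    fix k
    have s: "(\<lambda>m. pochhammer (norm a + real k) m / fact m * norm z ^ m) sums
        ((1 - norm z) powr (- (norm a + real k)))"
      using z1 by (intro binomial_series_sums_real) auto
    have "((\<lambda>m. pochhammer (norm a + real k) m / fact m * norm z ^ m) has_sum
        ((1 - norm z) powr (- (norm a + real k)))) UNIV"
      using s by (intro norm_summable_imp_has_sum)
        (simp_all add: sums_iff abs_mult abs_of_nonneg[OF pos])
    from has_sum_cmult_right[OF this, of "norm (C k) * norm z ^ k"]
    have "((\<lambda>m. g (k, m)) has_sum (norm (C k) * norm z ^ k * (1 - norm z) powr (- (norm a + real k)))) UNIV"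
      by (simp add: g_def)
    also have "norm (C k) * norm z ^ k * (1 - norm z) powr (- (norm a + real k)) =
        (1 - norm z) powr (- norm a) * (norm (C k) * q ^ k)"
      using z1 by (simp add: q_def powr_diff powr_minus powr_realpow power_divide field_simps powr_add)
    finally show "((\<lambda>m. g (k, m)) has_sum ((1 - norm z) powr (- norm a) * (norm (C k) * q ^ k))) UNIV" .
  next
    have "summable (\<lambda>k. norm (C k * of_real q ^ k))"
      unfolding C_def by (rule sums_hypergeo_2F1[OF c]) (use q in auto)
    hence "summable (\<lambda>k. (1 - norm z) powr (- norm a) * (norm (C k) * q ^ k))"
      using q by (intro summable_mult) (simp add: norm_mult norm_power)
    thus "(\<lambda>k. (1 - norm z) powr (- norm a) * (norm (C k) * q ^ k)) summable_on UNIV"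
      using q by (subst summable_on_UNIV_nonneg_real_iff) auto
  next
    show "g (k, m) \<ge> 0" for k m
      by (simp add: g_def pos)
  qed
  hence "(\<lambda>p. norm (T p)) summable_on (UNIV \<times> UNIV)"
  proof (rule Infinite_Sum.abs_summable_on_comparison_test')
    fix p :: "nat \<times> nat"
    obtain k m where p: "p = (k, m)" by (cases p)
    have "norm (pochhammer (a + of_nat k) m) \<le> pochhammer (norm a + real k) m"
      by (intro norm_pochhammer_le order_trans[OF norm_triangle_ineq]) simp
    hence "norm (hyp_coeff (a + of_nat k) 1 1 m) \<le> pochhammer (norm a + real k) m / fact m"
      by (simp add: hyp_coeff_def norm_divide norm_mult divide_right_mono flip: pochhammer_fact)
    hence "norm (C k) * norm z ^ k * (norm (hyp_coeff (a + of_nat k) 1 1 m) * norm z ^ m) \<le>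
           norm (C k) * norm z ^ k * (pochhammer (norm a + real k) m / fact m * norm z ^ m)"
      by (intro mult_left_mono mult_right_mono) auto
    thus "norm (T p) \<le> g p"
      by (simp add: p T_def g_def norm_mult norm_power power_add mult_ac)
  qed
  hence "T summable_on (UNIV \<times> UNIV)" by (rule Infinite_Sum.abs_summable_summable)
  then obtain S where S: "(T has_sum S) (UNIV \<times> UNIV)" by (auto simp: summable_on_def)

  \<comment> \<open>Summing over \<open>m\<close> first gives the transformed side; summing along
    \<open>k + m = n\<close> below gives the original series.\<close>
  have "((\<lambda>k. C k * (- z) ^ k * (1 - z) powr (- (a + of_nat k))) has_sum S) UNIV"
  proof (rule has_sum_SigmaD[OF S])
    fix k :: nat
    have "((\<lambda>m. hyp_coeff (a + of_nat k) 1 1 m * z ^ m) has_sum (1 - z) powr (- (a + of_nat k))) UNIV"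
      by (intro norm_summable_imp_has_sum binomial_series_sums sums_hypergeo_2F1(2))
         (use z1 Re_pos_notin_nonpos_Ints[of 1] in auto)
    from has_sum_cmult_right[OF this, of "C k * (- z) ^ k"]
    show "((\<lambda>m. T (k, m)) has_sum C k * (- z) ^ k * (1 - z) powr (- (a + of_nat k))) UNIV"
      by (simp add: T_def power_minus[of z] power_add mult_ac)
  qed
  also have "(\<lambda>k. C k * (- z) ^ k * (1 - z) powr (- (a + of_nat k))) =
      (\<lambda>k. (1 - z) powr (- a) * (C k * (z / (z - 1)) ^ k))"
  proof
    fix k
    have "(1 - z) powr (- (a + of_nat k)) = (1 - z) powr (- a) / (1 - z) ^ k"
      using z1 powr_diff[of "1 - z" "- a" "of_nat k"] by (simp add: powr_nat')
    moreover have "z / (z - 1) = (- z) / (1 - z)" using z1 by (simp add: divide_simps) (simp add: algebra_simps)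
    ultimately show "C k * (- z) ^ k * (1 - z) powr (- (a + of_nat k)) =
        (1 - z) powr (- a) * (C k * (z / (z - 1)) ^ k)"
      by (simp only: power_divide times_divide_eq_right mult_ac)
  qed
  finally have "(\<lambda>k. (1 - z) powr (- a) * (C k * (z / (z - 1)) ^ k)) sums S"
    by (rule has_sum_imp_sums)
  moreover have "(\<lambda>k. (1 - z) powr (- a) * (C k * (z / (z - 1)) ^ k)) sums
     ((1 - z) powr (- a) * eval_fps (fps_hypergeo [a, c - b] [c] 1) (z / (z - 1)))"
    unfolding C_def
  proof (intro sums_mult sums_hypergeo_2F1 c)
    have "1 - norm z \<le> norm (z - 1)" using norm_triangle_ineq3[of z 1] by simp
    hence "norm z < norm (z - 1)" using z by simp
    thus "norm (z / (z - 1)) < 1" by (simp add: norm_divide divide_less_eq)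
  qed
  ultimately have S1: "S = (1 - z) powr (- a) * eval_fps (fps_hypergeo [a, c - b] [c] 1) (z / (z - 1))"
    by (rule sums_unique2)

  have "bij_betw (\<lambda>(n, k). (k, n - k)) (SIGMA n:UNIV. {..n}) (UNIV \<times> UNIV :: (nat \<times> nat) set)"
    by (rule bij_betwI[of _ _ _ "\<lambda>(k, m). (k + m, k)"]) auto
  from has_sum_reindex_bij_betw[OF this, of T S] S
  have "((\<lambda>p. T (case p of (n, k) \<Rightarrow> (k, n - k))) has_sum S) (SIGMA n:UNIV. {..n})" by simp
  hence "((\<lambda>n. hyp_coeff a b c n * z ^ n) has_sum S) UNIV"
  proof (rule has_sum_SigmaD)
    fix n :: nat
    have "(\<Sum>k\<le>n. T (k, n - k)) = (\<Sum>k\<le>n. C k * (- 1) ^ k * hyp_coeff (a + of_nat k) 1 1 (n - k)) * z ^ n"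
      by (simp add: T_def sum_distrib_right)
    also have "\<dots> = hyp_coeff a b c n * z ^ n" unfolding C_def Pfaff_coeff[OF c] ..
    finally show "((\<lambda>k. T (case (n, k) of (n, k) \<Rightarrow> (k, n - k))) has_sum (hyp_coeff a b c n * z ^ n)) {..n}"
      using has_sum_finite[of "{..n}" "\<lambda>k. T (k, n - k)"] by simp
  qed
  hence "(\<lambda>n. hyp_coeff a b c n * z ^ n) sums S" by (rule has_sum_imp_sums)
  hence "eval_fps (fps_hypergeo [a, b] [c] 1) z = S"
    using sums_hypergeo_2F1(1)[OF c z1(1)] by (rule sums_unique2[symmetric])
  thus ?thesis using S1 by simp
qed

text \<open>In terms of \<open>1 - z\<close> the map is inversion, which preserves the nonpositive
  reals and therefore the slit plane.\<close>

lemma slit_plane_involution: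
  assumes "z \<in> slit_plane"
  shows "z / (z - 1) \<in> slit_plane" "1 - z / (z - 1) = inverse (1 - z)" "z / (z - 1) / (z / (z - 1) - 1) = z"
proof -
  have z: "1 - z \<notin> \<real>\<^sub>\<le>\<^sub>0" using assms slit_plane_iff by blast
  hence "z \<noteq> 1" by auto
  thus *: "1 - z / (z - 1) = inverse (1 - z)" by (simp add: divide_simps)
  show "z / (z - 1) / (z / (z - 1) - 1) = z" using \<open>z \<noteq> 1\<close> by (simp add: divide_simps)
  show "z / (z - 1) \<in> slit_plane"
    unfolding slit_plane_iff * using z by (simp add: nonpos_Reals_inverse_iff)
qed

theorem hyp2F1_Pfaff:
  assumes c: "c \<notin> \<int>\<^sub>\<le>\<^sub>0" and z: "z \<in> slit_plane"
  shows "hyp2F1 a b c z = (1 - z) powr (- a) * hyp2F1 a (c - b) c (z / (z - 1))"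
proof (rule holomorphic_eq_on_slit_plane[of "hyp2F1 a b c"
          "\<lambda>z. (1 - z) powr (- a) * hyp2F1 a (c - b) c (z / (z - 1))" "1 / 2"])
  have "(\<lambda>z. z / (z - 1)) holomorphic_on slit_plane"
    by (intro holomorphic_intros) auto
  hence "(\<lambda>z. hyp2F1 a (c - b) c (z / (z - 1))) holomorphic_on slit_plane"
    by (rule holomorphic_on_compose_gen[OF _ holomorphic_hyp2F1[OF c], unfolded o_def])
       (intro image_subsetI slit_plane_involution(1))
  moreover have "(\<lambda>z. (1 - z) powr (- a)) holomorphic_on slit_plane"
    by (intro holomorphic_intros slit_plane_iff[THEN iffD1])
  ultimately show "(\<lambda>z. (1 - z) powr (- a) * hyp2F1 a (c - b) c (z / (z - 1))) holomorphic_on slit_plane"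
    by (intro holomorphic_on_mult)
  fix w :: complex assume w: "norm w < 1 / 2"
  have "1 - norm w \<le> norm (w - 1)" using norm_triangle_ineq3[of w 1] by simp
  hence "norm w < norm (w - 1)" using w by simp
  hence "norm (w / (w - 1)) < 1" by (simp add: norm_divide divide_less_eq)
  thus "hyp2F1 a b c w = (1 - w) powr (- a) * hyp2F1 a (c - b) c (w / (w - 1))"
    using Pfaff_series[OF c w] w by (simp add: hyp2F1_eq_series[OF c])
qed (use z in \<open>simp_all add: holomorphic_hyp2F1[OF c] del: Compl_iff\<close>)

text \<open>Pfaff's transformation applied twice, the second time after exchanging the upper
  parameters; the involution brings the argument back to \<open>z\<close>.\<close>

theorem hyp2F1_Euler:
  assumes c: "c \<notin> \<int>\<^sub>\<le>\<^sub>0" and z: "z \<in> slit_plane"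
  shows "hyp2F1 a b c z = (1 - z) powr (c - a - b) * hyp2F1 (c - a) (c - b) c z"
proof -
  define w where "w = z / (z - 1)"
  note w = slit_plane_involution[OF z, folded w_def]
  have nz: "1 - z \<notin> \<real>\<^sub>\<le>\<^sub>0" using z slit_plane_iff by blast
  hence "1 - z \<noteq> 0" by auto
  have "hyp2F1 a b c z = (1 - z) powr (- a) * hyp2F1 (c - b) a c w"
    using hyp2F1_Pfaff[OF c z, of a b] by (simp add: w_def hyp2F1_commute)
  also have "hyp2F1 (c - b) a c w = (1 - w) powr (- (c - b)) * hyp2F1 (c - b) (c - a) c z"
    using hyp2F1_Pfaff[OF c w(1), of "c - b" a] w(3) by simp
  \<comment> \<open>\<open>Ln\<close> of an inverse is the negative logarithm only off the branch
    cut, where \<open>1 - z\<close> lies.\<close>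
  also have "(1 - w) powr (- (c - b)) = (1 - z) powr (c - b)"
    unfolding w(2) using nz \<open>1 - z \<noteq> 0\<close> by (simp add: powr_def Ln_inverse flip: mult_minus_left)
  also have "(1 - z) powr (- a) * ((1 - z) powr (c - b) * hyp2F1 (c - b) (c - a) c z) =
      (1 - z) powr (c - a - b) * hyp2F1 (c - a) (c - b) c z"
    by (simp add: hyp2F1_commute[of "c - b"] algebra_simps flip: powr_add)
  finally show ?thesis .
qed

section \<open>The integral transforms\<close>

lemma powr_of_real_pos: "p > 0 \<Longrightarrow> of_real p powr s = exp (s * complex_of_real (ln p))"
  by (simp add: powr_def Ln_of_real)

text \<open>The map \<open>u / (u - 1)\<close> is its own inverse, which yields image and
  injectivity; the absolute value of the Jacobian absorbs the reversal of orientation. The change of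
  variables theorem concerns Lebesgue measurable functions; continuity of \<open>f\<close> restores
  Borel measurability for \<open>lborel\<close>.\<close>

lemma set_integral_moebius_substitution:
  fixes f :: "real \<Rightarrow> complex"
  assumes cont: "continuous_on {..<0} f"
    and int: "set_integrable lborel {0<..<1} h"
    and h: "\<And>u. u \<in> {0<..<1} \<Longrightarrow> h u = of_real (1 / (1 - u) ^ 2) * f (u / (u - 1))"
  shows "set_integrable lborel {..<0} f"
    and "(LINT y:{..<0}|lborel. f y) = (LINT u:{0<..<1}|lborel. h u)"
proof -
  define g where "g = (\<lambda>u::real. u / (u - 1))"
  define g' where "g' = (\<lambda>u::real. - 1 / (1 - u) ^ 2)"
  have abs: "\<bar>g' u\<bar> *\<^sub>R f (g u) = h u" if "u \<in> {0<..<1}" for u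
    using h[OF that] by (simp add: g_def g'_def scaleR_conv_of_real)
  have img: "g ` {0<..<1} = {..<0}"
  proof safe
    fix u :: real assume "u \<in> {0<..<1}"
    thus "g u < 0" by (auto simp: g_def divide_less_0_iff)
  next
    fix y :: real assume "y < 0"
    hence "g (y / (y - 1)) = y" "y / (y - 1) \<in> {0<..<1}"
      by (auto simp: g_def divide_simps)
    thus "y \<in> g ` {0<..<1}" by (metis imageI)
  qed
  have inj: "inj_on g {0<..<1}"
    by (rule inj_on_inverseI[of _ g]) (auto simp: g_def divide_simps)
  have der: "(g has_field_derivative g' u) (at u within {0<..<1})" if "u \<in> {0<..<1}" for u
    unfolding g_def g'_def using that
    by (auto intro!: derivative_eq_intros simp: divide_simps power2_eq_square)
       (simp add: algebra_simps)
  have "set_integrable lebesgue {0<..<1} h"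
    using int unfolding set_integrable_def by (subst integrable_completion) auto
  hence "(\<lambda>u. \<bar>g' u\<bar> *\<^sub>R f (g u)) absolutely_integrable_on {0<..<1}"
    by (rule set_integrable_cong[THEN iffD1, rotated -1]) (auto simp: abs)
  hence "f absolutely_integrable_on g ` {0<..<1} \<and>
      integral (g ` {0<..<1}) f = integral {0<..<1} (\<lambda>u. \<bar>g' u\<bar> *\<^sub>R f (g u))"
    by (intro has_absolute_integral_change_of_variables_real[OF _ der inj, THEN iffD1] conjI refl) auto
  hence f: "f absolutely_integrable_on {..<0}"
      "integral {..<0} f = integral {0<..<1} (\<lambda>u. \<bar>g' u\<bar> *\<^sub>R f (g u))"
    unfolding img by auto
  have "set_borel_measurable lborel {..<0} f"
    by (rule set_borel_measurable_lborel_continuous[OF cont]) simp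
  thus *: "set_integrable lborel {..<0} f"
    using f(1) unfolding set_integrable_def set_borel_measurable_def
    by (subst (asm) integrable_completion) auto
  have "(LINT y:{..<0}|lborel. f y) = integral {0<..<1} (\<lambda>u. \<bar>g' u\<bar> *\<^sub>R f (g u))"
    using set_borel_integral_eq_integral(2)[OF *] f(2) by simp
  also have "\<dots> = integral {0<..<1} h"
    by (rule integral_cong) (rule abs)
  also have "\<dots> = (LINT u:{0<..<1}|lborel. h u)"
    using set_borel_integral_eq_integral(2)[OF int] by simp
  finally show "(LINT y:{..<0}|lborel. f y) = (LINT u:{0<..<1}|lborel. h u)" .
qed

text \<open>Pfaff's transformation carries a negative argument into the unit interval, where
  \<open>F\<close> is given by its series.\<close>

lemma w1_moebius:
  assumes "c \<notin> \<int>\<^sub>\<le>\<^sub>0" "u \<in> {0<..<1}"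
  shows "w1 (u / (u - 1)) a b c =
    of_real (1 - u) powr a * eval_fps (fps_hypergeo [a, c - b] [c] 1) (of_real u)"
proof -
  define z where "z = complex_of_real (u / (u - 1))"
  have "complex_of_real u \<in> slit_plane" using assms(2) by auto
  note inv = slit_plane_involution[OF this]
  have z: "z = of_real u / (of_real u - 1)" by (simp add: z_def)
  have "w1 (u / (u - 1)) a b c = (1 - z) powr (- a) * hyp2F1 a (c - b) c (z / (z - 1))"
    unfolding w1_def z_def[symmetric] by (rule hyp2F1_Pfaff[OF assms(1)]) (use inv(1) z in simp)
  also have "z / (z - 1) = of_real u" using inv(3) by (simp add: z)
  also have "1 - z = of_real (1 / (1 - u))" using inv(2) by (simp add: z divide_inverse)
  also have "of_real (1 / (1 - u)) powr (- a) = of_real (1 - u) powr a"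
    using assms(2) by (subst (1 2) powr_of_real_pos) (auto simp: ln_div)
  also have "hyp2F1 a (c - b) c (of_real u) = eval_fps (fps_hypergeo [a, c - b] [c] 1) (of_real u)"
    using assms by (intro hyp2F1_eq_series) auto
  finally show ?thesis .
qed

lemma continuous_on_w1_integrand:
  assumes "c \<notin> \<int>\<^sub>\<le>\<^sub>0" "x > 0"
  shows "continuous_on {..<0} (\<lambda>y. of_real (- y) powr p * of_real (1 - y) powr q *
            w1 y a b c * of_real (x - y) powr r)"
proof -
  have "continuous_on {..<0} (\<lambda>y. hyp2F1 a b c (of_real y))"
    by (rule continuous_on_compose2[OF holomorphic_on_imp_continuous_on[OF holomorphic_hyp2F1[OF assms(1)]]])
       (auto intro!: continuous_intros)
  thus ?thesis unfolding w1_def using assms(2)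
    by (intro continuous_intros continuous_on_powr_complex_const)
       (auto simp: complex_nonpos_Reals_iff simp del: of_real_diff of_real_minus)
qed

lemma w1_integrand_moebius:
  assumes c: "c \<notin> \<int>\<^sub>\<le>\<^sub>0" and x: "x > 0" and u: "u \<in> {0<..<1}"
  shows "hyp_kernel a (c - b) c (1 - b - \<mu>) u * (1 - (1 - of_real x) * of_real (1 - u)) powr (\<mu> - 1) =
    of_real (1 / (1 - u) ^ 2) * (of_real (- (u / (u - 1))) powr (c - 1) *
      of_real (1 - u / (u - 1)) powr (a + b - c) * w1 (u / (u - 1)) a b c *
      of_real (x - u / (u - 1)) powr (\<mu> - 1))"
proof -
  define R where "R = 1 - (1 - x) * (1 - u)"
  have "R = x * (1 - u) + u" by (simp add: R_def algebra_simps)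
  hence R: "R > 0" using x u by (auto intro: add_pos_pos)
  \<comment> \<open>All bases are positive reals, so each power is the exponential of a multiple of
    \<open>L\<close>, \<open>M\<close> or \<open>N\<close> and the claim reduces to comparing
    exponents. That of \<open>1 - u\<close> is
    \<open>- 2 - (c - 1) - (a + b - c) + a - (\<mu> - 1) = - b - \<mu>\<close>, whence
    \<open>e = 1 - b - \<mu>\<close>.\<close>
  define L M N where "L = complex_of_real (ln u)" and "M = complex_of_real (ln (1 - u))"
    and "N = complex_of_real (ln R)"
  define S where "S = eval_fps (fps_hypergeo [a, c - b] [c] 1) (complex_of_real u)"
  have u': "u > 0" "1 - u > 0" using u by auto
  have e1: "- (u / (u - 1)) = u / (1 - u)" "1 - u / (u - 1) = 1 / (1 - u)"
    using u by (simp_all add: divide_simps) (simp add: algebra_simps)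
  have e2: "x - u / (u - 1) = R / (1 - u)"
    using u by (simp add: R_def divide_simps) (simp add: algebra_simps)
  have "of_real (1 / (1 - u) ^ 2) = exp (- 2 * M)"
  proof -
    have "1 / (1 - u) ^ 2 = exp (- 2 * ln (1 - u))"
      using u' by (simp add: exp_minus exp_double divide_inverse)
    thus ?thesis unfolding M_def by (simp flip: exp_of_real)
  qed
  moreover have "of_real (- (u / (u - 1))) powr (c - 1) = exp ((c - 1) * (L - M))"
    unfolding e1 L_def M_def using u' by (subst powr_of_real_pos) (simp_all add: ln_div)
  moreover have "of_real (1 - u / (u - 1)) powr (a + b - c) = exp ((a + b - c) * (- M))"
    unfolding e1 M_def using u' by (subst powr_of_real_pos) (simp_all add: ln_div)
  moreover have "of_real (x - u / (u - 1)) powr (\<mu> - 1) = exp ((\<mu> - 1) * (N - M))"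
    unfolding e2 N_def M_def using u' R by (subst powr_of_real_pos) (simp_all add: ln_div)
  moreover have "w1 (u / (u - 1)) a b c = exp (a * M) * S"
    unfolding w1_moebius[OF c u] S_def M_def using u' by (subst powr_of_real_pos) simp_all
  moreover have "hyp_kernel a (c - b) c (1 - b - \<mu>) u = exp ((c - 1) * L) * exp ((- b - \<mu>) * M) * S"
    unfolding hyp_kernel_def Beta_kernel_def S_def L_def M_def using u'
    by (subst (1 2) powr_of_real_pos) simp_all
  moreover have "(1 - (1 - of_real x) * of_real (1 - u)) powr (\<mu> - 1) = exp ((\<mu> - 1) * N)"
  proof -
    have "1 - (1 - of_real x) * of_real (1 - u) = complex_of_real R" by (simp add: R_def)
    thus ?thesis unfolding N_def using R powr_of_real_pos[of R "\<mu> - 1"] by simp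
  qed
  ultimately show ?thesis
    by (simp add: algebra_simps flip: exp_add)
qed

text \<open>The common core of both halves: no modulus occurs, since the power of
  \<open>\<bar>1 - x\<bar>\<close> in (1) cancels the one inside \<open>w6\<close>. The reciprocal
  gamma functions are written \<open>rGamma\<close>, so zeros at poles of \<open>Gamma\<close> are
  included.\<close>

lemma w1_transform:
  assumes "Re (- a - \<mu> + 1) > 0" "Re (- b - \<mu> + 1) > 0" "Re c > 0" "c - a - b - \<mu> + 1 \<notin> \<int>\<^sub>\<le>\<^sub>0" "x > 0"
  defines "f \<equiv> (\<lambda>y. of_real (- y) powr (c - 1) * of_real (1 - y) powr (a + b - c) *
                w1 y a b c * of_real (x - y) powr (\<mu> - 1))"
  shows "set_integrable lborel {..<0} f"
    and "(LINT y:{..<0}|lborel. f y) =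
      Gamma (- a - \<mu> + 1) * Gamma (- b - \<mu> + 1) * Gamma c *
      rGamma (c - a - b - \<mu> + 1) * rGamma (1 - \<mu>) *
      of_real x powr (c + \<mu> - 1) * hyp2F1 (c - a) (c - b) (c - a - b - \<mu> + 1) (of_real (1 - x))"
proof -
  define e where "e = 1 - b - \<mu>"
  define h where "h = (\<lambda>u. hyp_kernel a (c - b) c e u *
     (1 - (1 - of_real x) * of_real (1 - u)) powr (\<mu> - 1))"
  have c: "c \<notin> \<int>\<^sub>\<le>\<^sub>0" using assms(3) by (rule Re_pos_notin_nonpos_Ints)
  have eqs: "c + e - a - (c - b) = - a - \<mu> + 1" "c + e - a = c - a - b - \<mu> + 1"
    "c + e - (c - b) = 1 - \<mu>" "e = - b - \<mu> + 1"
    by (simp_all add: e_def)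
  have hyps: "Re c > 0" "Re e > 0" "Re (c + e - a - (c - b)) > 0" "complex_of_real x \<notin> \<real>\<^sub>\<le>\<^sub>0"
    unfolding eqs using assms by auto
  have cont: "continuous_on {..<0} f"
    unfolding f_def by (rule continuous_on_w1_integrand[OF c assms(5)])
  have int: "set_integrable lborel {0<..<1} h"
    unfolding h_def by (rule set_integrable_hyp_integrand[OF hyps])
  have h: "h u = of_real (1 / (1 - u) ^ 2) * f (u / (u - 1))" if "u \<in> {0<..<1}" for u
    unfolding h_def f_def e_def by (rule w1_integrand_moebius[OF c assms(5) that])
  note sub = set_integral_moebius_substitution[OF cont int h]
  show "set_integrable lborel {..<0} f" by (rule sub(1))
  have "(LINT y:{..<0}|lborel. f y) = (LINT u:{0<..<1}|lborel. h u)" by (rule sub(2))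
  also have "\<dots> = hyp_integral a (c - b) c e (of_real x)"
    by (simp add: h_def hyp_integral_def eqs(3))
  also have "\<dots> = Gamma c * Gamma e * Gamma (c + e - a - (c - b)) * rGamma (c + e - a) *
      rGamma (c + e - (c - b)) * hyp2F1 e (c + e - a - (c - b)) (c + e - a) (1 - of_real x)"
    by (rule hyp_integral_eq_hyp2F1[OF hyps(1-3) _ hyps(4)]) (unfold eqs(2), rule assms(4))
  also have "hyp2F1 e (c + e - a - (c - b)) (c + e - a) (1 - of_real x) =
      of_real x powr (c + \<mu> - 1) * hyp2F1 (c - a) (c - b) (c - a - b - \<mu> + 1) (of_real (1 - x))"
  \<comment> \<open>Euler's transformation replaces the upper parameters
    \<open>1 - b - \<mu>\<close> and \<open>1 - a - \<mu>\<close> by \<open>c - a\<close> and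
    \<open>c - b\<close>; its exponent is \<open>c + \<mu> - 1\<close>, the power of
    \<open>x\<close> required.\<close>
  proof -
    have "hyp2F1 e (- a - \<mu> + 1) (c - a - b - \<mu> + 1) (of_real (1 - x)) =
       (1 - of_real (1 - x)) powr (c - a - b - \<mu> + 1 - e - (- a - \<mu> + 1)) *
       hyp2F1 (c - a - b - \<mu> + 1 - e) (c - a - b - \<mu> + 1 - (- a - \<mu> + 1)) (c - a - b - \<mu> + 1) (of_real (1 - x))"
      by (rule hyp2F1_Euler[OF assms(4)]) (use assms(5) in \<open>auto simp del: of_real_diff\<close>)
    moreover have "c - a - b - \<mu> + 1 - e = c - a" "c - a - b - \<mu> + 1 - (- a - \<mu> + 1) = c - b"
      "c - a - (- a - \<mu> + 1) = c + \<mu> - 1" "1 - of_real (1 - x) = complex_of_real x"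
      by (simp_all add: e_def)
    moreover have "1 - of_real x = complex_of_real (1 - x)" by simp
    ultimately show ?thesis unfolding eqs(1) unfolding eqs(2) by (simp only:)
  qed
  finally show "(LINT y:{..<0}|lborel. f y) =
      Gamma (- a - \<mu> + 1) * Gamma (- b - \<mu> + 1) * Gamma c *
      rGamma (c - a - b - \<mu> + 1) * rGamma (1 - \<mu>) *
      of_real x powr (c + \<mu> - 1) * hyp2F1 (c - a) (c - b) (c - a - b - \<mu> + 1) (of_real (1 - x))"
    unfolding eqs(1) unfolding eqs(2,3) unfolding eqs(4) by (simp add: mult_ac)
qed

lemma set_integral_reflect_greaterThan_1:
  fixes f :: "real \<Rightarrow> complex"
  assumes "set_integrable lborel {..<0} f"
  shows "set_integrable lborel {1<..} (\<lambda>y. f (1 - y))"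
    and "(LINT y:{1<..}|lborel. f (1 - y)) = (LINT y:{..<0}|lborel. f y)"
proof -
  have ind: "indicat_real {..<0} (1 - y) = indicat_real {1<..} y" for y :: real
    by (simp add: indicator_def)
  show "set_integrable lborel {1<..} (\<lambda>y. f (1 - y))"
    using lborel_integrable_real_affine[OF assms[unfolded set_integrable_def], of "-1" 1]
    by (simp add: set_integrable_def ind)
  show "(LINT y:{1<..}|lborel. f (1 - y)) = (LINT y:{..<0}|lborel. f y)"
    unfolding set_lebesgue_integral_def
    by (subst (2) lborel_integral_real_affine[of "-1" _ 1]) (simp_all add: ind)
qed

text \<open>Integrability is asserted next to each value because the integral of a non-integrable
  function is 0 by convention, so an equation alone would not express convergence.\<close>

theorem mainTheorem11:
  fixes a b c \<mu> :: complex
  shows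
    "(Re (- a - \<mu> + 1) > 0 \<and> Re (- b - \<mu> + 1) > 0 \<and> Re c > 0 \<and>
      c \<notin> \<int>\<^sub>\<le>\<^sub>0 \<and> (c + \<mu>) - (a + \<mu>) - (b + \<mu>) + 1 \<notin> \<int>\<^sub>\<le>\<^sub>0 \<longrightarrow>
      (\<forall>x \<in> {0<..<1} \<union> {1<..}.
        interval_lebesgue_integrable lborel (-\<infinity>) 0
          (\<lambda>y::real. of_real (- y) powr (c - 1) * of_real (1 - y) powr (a + b - c) *
                w1 y a b c * of_real (x - y) powr (\<mu> - 1)) \<and>
        (LBINT y=-\<infinity>..0. of_real (- y) powr (c - 1) * of_real (1 - y) powr (a + b - c) *
                w1 y a b c * of_real (x - y) powr (\<mu> - 1)) =
          Gamma (- a - \<mu> + 1) * Gamma (- b - \<mu> + 1) * Gamma c *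
          rGamma (c - a - b - \<mu> + 1) * rGamma (1 - \<mu>) *
          of_real x powr (c + \<mu> - 1) * of_real \<bar>1 - x\<bar> powr (a + b - c + \<mu>) *
          w6 x (a + \<mu>) (b + \<mu>) (c + \<mu>)))
     \<and>
     (Re (- a - \<mu> + 1) > 0 \<and> Re (- b - \<mu> + 1) > 0 \<and> Re (a + b - c + 1) > 0 \<and>
      a + b - c + 1 \<notin> \<int>\<^sub>\<le>\<^sub>0 \<and> 2 - (c + \<mu>) \<notin> \<int>\<^sub>\<le>\<^sub>0 \<longrightarrow>
      (\<forall>x \<in> {..<0} \<union> {0<..<1}.
        interval_lebesgue_integrable lborel 1 \<infinity>
          (\<lambda>y::real. of_real y powr (c - 1) * of_real (y - 1) powr (a + b - c) *
                w5 y a b c * of_real (y - x) powr (\<mu> - 1)) \<and>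
        (LBINT y=1..\<infinity>. of_real y powr (c - 1) * of_real (y - 1) powr (a + b - c) *
                w5 y a b c * of_real (y - x) powr (\<mu> - 1)) =
          Gamma (- a - \<mu> + 1) * Gamma (- b - \<mu> + 1) * Gamma (a + b - c + 1) *
          rGamma (2 - c - \<mu>) * rGamma (1 - \<mu>) *
          of_real \<bar>x\<bar> powr (c + \<mu> - 1) * of_real (1 - x) powr (a + b - c + \<mu>) *
          w2 x (a + \<mu>) (b + \<mu>) (c + \<mu>)))"
proof (intro conjI impI ballI; elim conjE)
  fix x :: real
  assume hyps: "Re (- a - \<mu> + 1) > 0" "Re (- b - \<mu> + 1) > 0" "Re c > 0"
    "(c + \<mu>) - (a + \<mu>) - (b + \<mu>) + 1 \<notin> \<int>\<^sub>\<le>\<^sub>0" and x: "x \<in> {0<..<1} \<union> {1<..}"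
  have eq: "(c + \<mu>) - (a + \<mu>) - (b + \<mu>) + 1 = c - a - b - \<mu> + 1" by simp
  have "x > 0" "x \<noteq> 1" using x by auto
  note T = w1_transform[OF hyps(1-3) hyps(4)[unfolded eq] \<open>x > 0\<close>]
  have ei: "einterval (- \<infinity>) 0 = {..<0::real}" by (simp add: zero_ereal_def)
  show "interval_lebesgue_integrable lborel (-\<infinity>) 0
          (\<lambda>y::real. of_real (- y) powr (c - 1) * of_real (1 - y) powr (a + b - c) *
                w1 y a b c * of_real (x - y) powr (\<mu> - 1))"
    using T(1) by (simp add: interval_lebesgue_integrable_def ei)
  have "w6 x (a + \<mu>) (b + \<mu>) (c + \<mu>) = of_real \<bar>1 - x\<bar> powr ((c + \<mu>) - (a + \<mu>) - (b + \<mu>)) *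
      hyp2F1 (c - a) (c - b) (c - a - b - \<mu> + 1) (of_real (1 - x))"
    unfolding w6_def eq by simp
  hence "of_real \<bar>1 - x\<bar> powr (a + b - c + \<mu>) * w6 x (a + \<mu>) (b + \<mu>) (c + \<mu>) =
      of_real \<bar>1 - x\<bar> powr ((a + b - c + \<mu>) + ((c + \<mu>) - (a + \<mu>) - (b + \<mu>))) *
        hyp2F1 (c - a) (c - b) (c - a - b - \<mu> + 1) (of_real (1 - x))"
    by (simp only: powr_add[symmetric] mult.assoc[symmetric])
  \<comment> \<open>The exponents add up to 0. The point \<open>x = 1\<close> has to be excluded, as
    \<open>0 powr 0 = 0\<close>.\<close>
  also have "of_real \<bar>1 - x\<bar> powr ((a + b - c + \<mu>) + ((c + \<mu>) - (a + \<mu>) - (b + \<mu>))) = (1 :: complex)"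
    using \<open>x \<noteq> 1\<close> by simp
  finally have w6: "of_real \<bar>1 - x\<bar> powr (a + b - c + \<mu>) * w6 x (a + \<mu>) (b + \<mu>) (c + \<mu>) =
      hyp2F1 (c - a) (c - b) (c - a - b - \<mu> + 1) (of_real (1 - x))" by simp
  show "(LBINT y=-\<infinity>..0. of_real (- y) powr (c - 1) * of_real (1 - y) powr (a + b - c) *
                w1 y a b c * of_real (x - y) powr (\<mu> - 1)) =
          Gamma (- a - \<mu> + 1) * Gamma (- b - \<mu> + 1) * Gamma c *
          rGamma (c - a - b - \<mu> + 1) * rGamma (1 - \<mu>) *
          of_real x powr (c + \<mu> - 1) * of_real \<bar>1 - x\<bar> powr (a + b - c + \<mu>) *
          w6 x (a + \<mu>) (b + \<mu>) (c + \<mu>)"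
    using T(2) unfolding mult.assoc w6 by (simp add: interval_lebesgue_integral_def ei mult.assoc)
next
  fix x :: real
  assume hyps: "Re (- a - \<mu> + 1) > 0" "Re (- b - \<mu> + 1) > 0" "Re (a + b - c + 1) > 0"
    "2 - (c + \<mu>) \<notin> \<int>\<^sub>\<le>\<^sub>0" and x: "x \<in> {..<0} \<union> {0<..<1}"
  define d where "d = a + b - c + 1"
  \<comment> \<open>Replacing \<open>c\<close> by \<open>d\<close> is an involution that exchanges
    the two exponents \<open>c - 1\<close> and \<open>a + b - c\<close>, just as
    \<open>y \<mapsto> 1 - y\<close> exchanges the bases.\<close>
  have eqs: "d - a - b - \<mu> + 1 = 2 - (c + \<mu>)" "a + b - d = c - 1" "d - 1 = a + b - c"
    "d + \<mu> - 1 = a + b - c + \<mu>" "d - a = b - c + 1" "d - b = a - c + 1"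
    by (simp_all add: d_def)
  have "1 - x > 0" "x \<noteq> 0" using x by auto
  have d: "Re d > 0" "d - a - b - \<mu> + 1 \<notin> \<int>\<^sub>\<le>\<^sub>0"
    unfolding eqs(1) using hyps(3,4) by (simp_all add: d_def)
  note T = w1_transform[OF hyps(1,2) d \<open>1 - x > 0\<close>]
  note R = set_integral_reflect_greaterThan_1[OF T(1)]
  have f: "(\<lambda>y. of_real (- (1 - y)) powr (d - 1) * of_real (1 - (1 - y)) powr (a + b - d) *
                w1 (1 - y) a b d * of_real (1 - x - (1 - y)) powr (\<mu> - 1)) =
     (\<lambda>y. of_real y powr (c - 1) * of_real (y - 1) powr (a + b - c) *
                w5 y a b c * of_real (y - x) powr (\<mu> - 1))"
    unfolding eqs w1_def w5_def d_def[symmetric] by (simp add: mult_ac)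
  have ei: "einterval 1 \<infinity> = {1::real<..}" by (simp add: one_ereal_def)
  show "interval_lebesgue_integrable lborel 1 \<infinity>
          (\<lambda>y::real. of_real y powr (c - 1) * of_real (y - 1) powr (a + b - c) *
                w5 y a b c * of_real (y - x) powr (\<mu> - 1))"
    using R(1) unfolding f by (simp add: interval_lebesgue_integrable_def ei)
  have "w2 x (a + \<mu>) (b + \<mu>) (c + \<mu>) = of_real \<bar>x\<bar> powr (1 - (c + \<mu>)) *
      hyp2F1 (a - c + 1) (b - c + 1) (2 - (c + \<mu>)) (of_real x)"
    unfolding w2_def by simp
  hence "of_real \<bar>x\<bar> powr (c + \<mu> - 1) * w2 x (a + \<mu>) (b + \<mu>) (c + \<mu>) =
      of_real \<bar>x\<bar> powr ((c + \<mu> - 1) + (1 - (c + \<mu>))) *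
        hyp2F1 (a - c + 1) (b - c + 1) (2 - (c + \<mu>)) (of_real x)"
    by (simp only: powr_add[symmetric] mult.assoc[symmetric])
  also have "of_real \<bar>x\<bar> powr ((c + \<mu> - 1) + (1 - (c + \<mu>))) = (1 :: complex)"
    using \<open>x \<noteq> 0\<close> by simp
  \<comment> \<open>The parameters \<open>d - a\<close> and \<open>d - b\<close> are the upper
    parameters of \<open>w2\<close> in reverse order, hence the use of symmetry.\<close>
  finally have w2: "hyp2F1 (d - a) (d - b) (d - a - b - \<mu> + 1) (of_real (1 - (1 - x))) =
      of_real \<bar>x\<bar> powr (c + \<mu> - 1) * w2 x (a + \<mu>) (b + \<mu>) (c + \<mu>)"
    unfolding eqs(1) unfolding eqs by (simp add: hyp2F1_commute)
  have eq2: "2 - c - \<mu> = 2 - (c + \<mu>)" by simp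
  show "(LBINT y=1..\<infinity>. of_real y powr (c - 1) * of_real (y - 1) powr (a + b - c) *
                w5 y a b c * of_real (y - x) powr (\<mu> - 1)) =
          Gamma (- a - \<mu> + 1) * Gamma (- b - \<mu> + 1) * Gamma (a + b - c + 1) *
          rGamma (2 - c - \<mu>) * rGamma (1 - \<mu>) *
          of_real \<bar>x\<bar> powr (c + \<mu> - 1) * of_real (1 - x) powr (a + b - c + \<mu>) *
          w2 x (a + \<mu>) (b + \<mu>) (c + \<mu>)"
    using R(2) unfolding f T(2) w2 unfolding eqs(1,4) eq2
    by (simp add: interval_lebesgue_integral_def ei d_def mult_ac)
qed

end
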